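(* Let $\rho_0 \in \mathcal{D}(\mathcal{H}_d)$ be a pure magic state and let $\rho_1=(\mathbb{1}-\rho_0)/(d-1)$ be its orthogonal complement, where $\mathbb{1}$ is the identity operator on $\mathcal{H}_d$. Then for every positive integer $n$, the states $\rho_0^{\otimes n}$ and $\rho_1^{\otimes n}$ cannot be unambiguously distinguished by PWF POVMs (on $\mathcal{H}_d^{\otimes n}$).
   Context: $\mathcal{H}_d$ is a Hilbert space of odd dimension $d\ge 3$; if $d$ is not prime, $\mathcal{H}_d$ is understood as a given tensor product of Hilbert spaces each of odd prime dimension. $\mathcal{D}(\mathcal{H})$ is the set of density operators on $\mathcal{H}$. Phase-space operators. For $d$ an odd prime with computational basis $\{|j\rangle\}_{j\in\mathbb{Z}_d}$, let $X|j\rangle=|j+1 \bmod d\rangle$, $Z|j\rangle=e^{2\pi i j/d}|j\rangle$. For $\mathbf{u}=(a_1,a_2)\in\mathbb{Z}_d\times\mathbb{Z}_d$ let $T_{\mathbf{u}}=e^{-(d+1)\pi i a_1a_2/d}Z^{a_1}X^{a_2}$, $A_{\mathbf{0}}=\frac1d\sum_{\mathbf{u}}T_{\mathbf{u}}$, $A_{\mathbf{u}}=T_{\mathbf{u}}A_{\mathbf{0}}T_{\mathbf{u}}^\dagger$. For a tensor product of odd-prime-dimensional systems (in particular for several copies of a system), the phase space is the product of the individual phase spaces, and $T_{\mathbf{u}}$ and $A_{\mathbf{u}}$ are the tensor products of the corresponding single-system operators. Wigner functions. On a system of total dimension $D$, a Hermitian operator $H$ (e.g. a state) has discrete Wigner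 function $W_H(\mathbf{u})=\frac1D\operatorname{Tr}[A_{\mathbf{u}}H]$; a POVM effect $E$ has $W(E|\mathbf{u})=\operatorname{Tr}[EA_{\mathbf{u}}]$. A state or effect is PWF (has positive Wigner functions) if this function is $\ge 0$ at all $\mathbf{u}$. A PWF POVM is a finite POVM all of whose effects are PWF. Stabilizer and magic states. A pure stabilizer state is a rank-one projector of the form $\frac{1}{|G|}\sum_{g\in G} g$, where $G$ is a finite abelian group of unitaries, each a unit-modulus scalar multiple of some $T_{\mathbf{u}}$, containing no scalar operator other than the identity (so $|G|=D$). A magic state is a density operator not in the convex hull of the pure stabilizer states; a pure magic state is thus a pure state that is not a pure stabilizer state. Unambiguous discrimination. States $\sigma_0,\sigma_1$ can be unambiguously distinguished by PWF POVMs if there is a PWF POVM $\{E_0,E_1,E_?\}$ (with $E_?$, the inconclusive outcome, possibly zero) such that $\operatorname{Tr}(E_0\sigma_1)=\operatorname{Tr}(E_1\sigma_0)=0$, $\operatorname{Tr}(E_0\sigma_0)>0$ and $\operatorname{Tr}(E_1\sigma_1)>0$. *)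

theory Defs
  imports
    "HOL-Computational_Algebra.Primes"
    "HOL-Algebra.Group"
    "Jordan_Normal_Form.Schur_Decomposition"
    "Jordan_Normal_Form.DL_Rank"
begin

definition trace :: "'a :: comm_monoid_add mat \<Rightarrow> 'a" where
  "trace A = (\<Sum>i<dim_row A. A $$ (i, i))"

text \<open>The sum of a finite family of $D \times D$ matrices. Matrices of arbitrary size carry no
  global zero, so the sum is taken entrywise.\<close>

definition mat_sum :: "nat \<Rightarrow> ('i \<Rightarrow> complex mat) \<Rightarrow> 'i set \<Rightarrow> complex mat" where
  "mat_sum D f S = mat D D (\<lambda>(i, j). \<Sum>x\<in>S. f x $$ (i, j))"

text \<open>In the order on \<^typ>\<open>complex\<close>, \<open>0 \<le> z\<close> says that \<open>z\<close> is real and nonnegative, and likewise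
  \<open>0 < z\<close>. Hence positive semidefinite matrices are Hermitian.\<close>

definition positive_semidefinite :: "nat \<Rightarrow> complex mat \<Rightarrow> bool" where
  "positive_semidefinite D A \<longleftrightarrow>
     A \<in> carrier_mat D D \<and> (\<forall>v\<in>carrier_vec D. 0 \<le> (A *\<^sub>v v) \<bullet>c v)"

definition density_operator :: "nat \<Rightarrow> complex mat \<Rightarrow> bool" where
  "density_operator D \<rho> \<longleftrightarrow> positive_semidefinite D \<rho> \<and> trace \<rho> = 1"

definition rank_one_projector :: "nat \<Rightarrow> complex mat \<Rightarrow> bool" where
  "rank_one_projector D P \<longleftrightarrow>
     P \<in> carrier_mat D D \<and> mat_adjoint P = P \<and> P * P = P \<and> vec_space.rank D P = 1"

text \<open>The basis vector \<open>|i\<rangle> \<otimes> |j\<rangle>\<close> has index \<open>i * dim B + j\<close>.\<close>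

definition kron :: "complex mat \<Rightarrow> complex mat \<Rightarrow> complex mat" where
  "kron A B = mat (dim_row A * dim_row B) (dim_col A * dim_col B)
     (\<lambda>(i, j). A $$ (i div dim_row B, j div dim_col B) * B $$ (i mod dim_row B, j mod dim_col B))"

definition tensor_list :: "complex mat list \<Rightarrow> complex mat" where
  "tensor_list As = foldr kron As (1\<^sub>m 1)"

definition tensor_power :: "nat \<Rightarrow> complex mat \<Rightarrow> complex mat" where
  "tensor_power n A = tensor_list (replicate n A)"

text \<open>Elements of $\mathbb{Z}_p$ are represented by the natural numbers below \<open>p\<close>.\<close>

definition shift_op :: "nat \<Rightarrow> complex mat" where
  "shift_op p = mat p p (\<lambda>(i, j). if i = (j + 1) mod p then 1 else 0)"

definition clock_op :: "nat \<Rightarrow> complex mat" where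
  "clock_op p = mat p p (\<lambda>(i, j). if i = j then cis (2 * pi * real j / real p) else 0)"

definition point_set :: "nat \<Rightarrow> (nat \<times> nat) set" where
  "point_set p = {..<p} \<times> {..<p}"

definition heisenberg_weyl1 :: "nat \<Rightarrow> nat \<times> nat \<Rightarrow> complex mat" where
  "heisenberg_weyl1 p = (\<lambda>(a1, a2).
     cis (- ((real p + 1) * pi * real a1 * real a2 / real p)) \<cdot>\<^sub>m
       (clock_op p ^\<^sub>m a1 * shift_op p ^\<^sub>m a2))"

definition phase_point_zero :: "nat \<Rightarrow> complex mat" where
  "phase_point_zero p = (1 / of_nat p) \<cdot>\<^sub>m mat_sum p (heisenberg_weyl1 p) (point_set p)"

definition phase_point1 :: "nat \<Rightarrow> nat \<times> nat \<Rightarrow> complex mat" where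
  "phase_point1 p u =
     heisenberg_weyl1 p u * phase_point_zero p * mat_adjoint (heisenberg_weyl1 p u)"

text \<open>A system is given by the list \<open>ps\<close> of the dimensions of its tensor factors; its total
  dimension is \<open>prod_list ps\<close>, and \<open>n\<close> copies of it form the system \<open>concat (replicate n ps)\<close>.\<close>

definition phase_space :: "nat list \<Rightarrow> (nat \<times> nat) list set" where
  "phase_space ps = listset (map point_set ps)"

definition heisenberg_weyl :: "nat list \<Rightarrow> (nat \<times> nat) list \<Rightarrow> complex mat" where
  "heisenberg_weyl ps us = tensor_list (map2 heisenberg_weyl1 ps us)"

definition phase_point :: "nat list \<Rightarrow> (nat \<times> nat) list \<Rightarrow> complex mat" where
  "phase_point ps us = tensor_list (map2 phase_point1 ps us)"

definition wigner_effect :: "nat list \<Rightarrow> complex mat \<Rightarrow> (nat \<times> nat) list \<Rightarrow> complex" where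
  "wigner_effect ps E u = trace (E * phase_point ps u)"

definition pwf_effect :: "nat list \<Rightarrow> complex mat \<Rightarrow> bool" where
  "pwf_effect ps E \<longleftrightarrow> (\<forall>u\<in>phase_space ps. 0 \<le> wigner_effect ps E u)"

definition povm :: "nat \<Rightarrow> complex mat list \<Rightarrow> bool" where
  "povm D Es \<longleftrightarrow>
     (\<forall>E\<in>set Es. positive_semidefinite D E) \<and>
     mat_sum D (\<lambda>k. Es ! k) {..<length Es} = 1\<^sub>m D"

definition pwf_povm :: "nat list \<Rightarrow> complex mat list \<Rightarrow> bool" where
  "pwf_povm ps Es \<longleftrightarrow> povm (prod_list ps) Es \<and> (\<forall>E\<in>set Es. pwf_effect ps E)"

definition unambiguously_distinguishable_pwf ::
    "nat list \<Rightarrow> complex mat \<Rightarrow> complex mat \<Rightarrow> bool" where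
  "unambiguously_distinguishable_pwf ps \<sigma>0 \<sigma>1 \<longleftrightarrow>
     (\<exists>E0 E1 Einc. pwf_povm ps [E0, E1, Einc] \<and>
        trace (E0 * \<sigma>1) = 0 \<and> trace (E1 * \<sigma>0) = 0 \<and>
        0 < trace (E0 * \<sigma>0) \<and> 0 < trace (E1 * \<sigma>1))"

definition stabilizer_group :: "nat list \<Rightarrow> complex mat set \<Rightarrow> bool" where
  "stabilizer_group ps G \<longleftrightarrow>
     finite G \<and>
     comm_group \<lparr>carrier = G, monoid.mult = (*), one = 1\<^sub>m (prod_list ps)\<rparr> \<and>
     (\<forall>g\<in>G. g * mat_adjoint g = 1\<^sub>m (prod_list ps)) \<and>
     (\<forall>g\<in>G. \<exists>c u. cmod c = 1 \<and> u \<in> phase_space ps \<and> g = c \<cdot>\<^sub>m heisenberg_weyl ps u) \<and>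
     (\<forall>c. c \<cdot>\<^sub>m 1\<^sub>m (prod_list ps) \<in> G \<longrightarrow> c = 1)"

definition pure_stabilizer_state :: "nat list \<Rightarrow> complex mat \<Rightarrow> bool" where
  "pure_stabilizer_state ps P \<longleftrightarrow>
     rank_one_projector (prod_list ps) P \<and>
     (\<exists>G. stabilizer_group ps G \<and>
        P = (1 / of_nat (card G)) \<cdot>\<^sub>m mat_sum (prod_list ps) (\<lambda>g. g) G)"

definition mat_convex_hull :: "nat \<Rightarrow> complex mat set \<Rightarrow> complex mat set" where
  "mat_convex_hull D K =
     {\<rho>. \<exists>S w. finite S \<and> S \<subseteq> K \<and> (\<forall>\<sigma>\<in>S. 0 \<le> w \<sigma>) \<and> sum w S = (1 :: real) \<and>
          \<rho> = mat_sum D (\<lambda>\<sigma>. complex_of_real (w \<sigma>) \<cdot>\<^sub>m \<sigma>) S}"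

definition magic_state :: "nat list \<Rightarrow> complex mat \<Rightarrow> bool" where
  "magic_state ps \<rho> \<longleftrightarrow>
     density_operator (prod_list ps) \<rho> \<and>
     \<rho> \<notin> mat_convex_hull (prod_list ps) {P. pure_stabilizer_state ps P}"

definition pure_magic_state :: "nat list \<Rightarrow> complex mat \<Rightarrow> bool" where
  "pure_magic_state ps \<rho> \<longleftrightarrow> rank_one_projector (prod_list ps) \<rho> \<and> magic_state ps \<rho>"

end

theory Submission
  imports Defs
begin

text \<open>Only the effect \<open>E\<^sub>0\<close> matters. Let \<open>\<psi>\<close> be the pure magic state, \<open>D\<close> the dimension and \<open>S\<close> the
  set of phase-space points \<open>u\<close> with \<open>Tr (A\<^sub>u \<psi>) = 1\<close>, equivalently \<open>A\<^sub>u \<psi> = \<psi>\<close>. The products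
  \<open>A\<^sub>u A\<^sub>v\<close> with \<open>u, v \<in> S\<close> are Weyl operators fixing \<open>\<psi>\<close>, so the stabilizer of \<open>\<psi>\<close> has at least
  \<open>|S|\<close> elements; if \<open>|S| \<ge> D\<close>, then \<open>\<psi>\<close> is the average of its stabilizer, hence a pure stabilizer
  state. So \<open>|S| < D\<close>.

  The complement \<open>\<rho>\<^sub>1\<close> has a nonnegative Wigner function, because \<open>A\<^sub>u \<le> 1\<close>, and this function
  vanishes exactly on \<open>S\<close>. Put (\<open>witness\<close> below) \<open>\<Phi> = \<psi> + (\<Sum>u\<in>S. 1 - A\<^sub>u) / (D - |S|)\<close>. Then \<open>\<Phi> \<ge> \<psi>\<close>, and since
  \<open>Tr A\<^sub>u = 1\<close> and \<open>Tr (A\<^sub>u A\<^sub>v) = D \<delta>\<^sub>u\<^sub>v\<close>, the Wigner function of \<open>\<Phi>\<close> vanishes on \<open>S\<close>. Hence the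
  Wigner function of the \<open>n\<close>-fold power of \<open>\<Phi>\<close> vanishes wherever that of the \<open>n\<close>-fold power of
  \<open>\<rho>\<^sub>1\<close> does. A PWF effect \<open>E\<close> with zero probability on the latter therefore has zero probability
  on the former, and a fortiori on the \<open>n\<close>-fold power of \<open>\<psi>\<close>.\<close>

section \<open>Matrices, traces and Kronecker products\<close>

lemma mat_adjoint_carrier [simp]: "A \<in> carrier_mat m n \<Longrightarrow> mat_adjoint A \<in> carrier_mat n m"
  by (auto simp: mat_adjoint_def)

lemma mat_adjoint_dim [simp]: "dim_row (mat_adjoint A) = dim_col A" "dim_col (mat_adjoint A) = dim_row A"
  by (auto simp: mat_adjoint_def)

lemma mat_adjoint_index [simp]:
  fixes A :: "complex mat"
  assumes "i < dim_col A" "j < dim_row A"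
  shows "mat_adjoint A $$ (i, j) = cnj (A $$ (j, i))"
  using assms by (simp add: mat_adjoint_def mat_of_rows_index)

lemma mat_adjoint_mult:
  fixes A B :: "complex mat"
  assumes "A \<in> carrier_mat l m" "B \<in> carrier_mat m n"
  shows "mat_adjoint (A * B) = mat_adjoint B * mat_adjoint A"
  using assms by (intro eq_matI) (auto simp: scalar_prod_def mult.commute)

lemma mat_adjoint_smult:
  fixes A :: "complex mat"
  shows "mat_adjoint (c \<cdot>\<^sub>m A) = cnj c \<cdot>\<^sub>m mat_adjoint A"
  by (intro eq_matI) auto

lemma mat_adjoint_one [simp]: "mat_adjoint (1\<^sub>m n) = (1\<^sub>m n :: complex mat)"
  by (intro eq_matI) auto

lemma mat_adjoint_minus:
  fixes A B :: "complex mat"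
  assumes "A \<in> carrier_mat m n" "B \<in> carrier_mat m n"
  shows "mat_adjoint (A - B) = mat_adjoint A - mat_adjoint B"
  using assms by (intro eq_matI) auto

lemma trace_mult_sum:
  assumes "A \<in> carrier_mat m n" "B \<in> carrier_mat n m"
  shows "trace (A * B) = (\<Sum>i<m. \<Sum>j<n. A $$ (i, j) * B $$ (j, i))"
  using assms by (simp add: trace_def scalar_prod_def atLeast0LessThan)

lemma trace_mult_commute:
  fixes A B :: "complex mat"
  assumes "A \<in> carrier_mat m n" "B \<in> carrier_mat n m"
  shows "trace (A * B) = trace (B * A)"
  unfolding trace_mult_sum[OF assms] trace_mult_sum[OF assms(2,1)]
  by (subst sum.swap) (simp add: mult.commute)

lemma trace_add:
  assumes "A \<in> carrier_mat n n" "B \<in> carrier_mat n n"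
  shows "trace (A + B) = trace A + (trace B :: complex)"
  using assms by (simp add: trace_def sum.distrib)

lemma trace_minus:
  assumes "A \<in> carrier_mat n n" "B \<in> carrier_mat n n"
  shows "trace (A - B) = trace A - (trace B :: complex)"
  using assms by (simp add: trace_def sum_subtractf)

lemma trace_smult:
  assumes "A \<in> carrier_mat n n"
  shows "trace (c \<cdot>\<^sub>m A) = c * (trace A :: complex)"
  using assms by (simp add: trace_def sum_distrib_left)

lemma trace_one [simp]: "trace (1\<^sub>m n) = (of_nat n :: complex)"
  by (simp add: trace_def)

lemma mat_sum_carrier [simp]: "mat_sum D f S \<in> carrier_mat D D"
  "dim_row (mat_sum D f S) = D" "dim_col (mat_sum D f S) = D"
  by (auto simp: mat_sum_def)

lemma mat_sum_index [simp]:
  "i < D \<Longrightarrow> j < D \<Longrightarrow> mat_sum D f S $$ (i, j) = (\<Sum>x\<in>S. f x $$ (i, j))"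
  by (simp add: mat_sum_def)

lemma mat_sum_mult_right:
  assumes "\<And>x. x \<in> S \<Longrightarrow> f x \<in> carrier_mat D D" "B \<in> carrier_mat D D"
  shows "mat_sum D f S * B = mat_sum D (\<lambda>x. f x * B) S"
proof (intro eq_matI)
  fix i j assume "i < dim_row (mat_sum D (\<lambda>x. f x * B) S)" "j < dim_col (mat_sum D (\<lambda>x. f x * B) S)"
  then have ij: "i < D" "j < D" by auto
  have "(mat_sum D f S * B) $$ (i, j) = (\<Sum>k = 0..<D. \<Sum>x\<in>S. f x $$ (i, k) * B $$ (k, j))"
    using ij assms by (simp add: scalar_prod_def sum_distrib_right)
  also have "\<dots> = (\<Sum>x\<in>S. \<Sum>k = 0..<D. f x $$ (i, k) * B $$ (k, j))"
    by (rule sum.swap)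
  also have "\<dots> = mat_sum D (\<lambda>x. f x * B) S $$ (i, j)"
    unfolding mat_sum_index[OF ij]
  proof (intro sum.cong refl)
    fix x assume "x \<in> S"
    then have "f x \<in> carrier_mat D D" by (rule assms)
    then show "(\<Sum>k = 0..<D. f x $$ (i, k) * B $$ (k, j)) = (f x * B) $$ (i, j)"
      using ij assms(2) by (simp add: scalar_prod_def)
  qed
  finally show "(mat_sum D f S * B) $$ (i, j) = mat_sum D (\<lambda>x. f x * B) S $$ (i, j)" .
qed (use assms in auto)

lemma trace_mat_sum:
  assumes "\<And>x. x \<in> S \<Longrightarrow> f x \<in> carrier_mat D D"
  shows "trace (mat_sum D f S) = (\<Sum>x\<in>S. trace (f x))"
proof -
  have "trace (mat_sum D f S) = (\<Sum>x\<in>S. \<Sum>i<D. f x $$ (i, i))"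
    by (simp add: trace_def) (rule sum.swap)
  also have "\<dots> = (\<Sum>x\<in>S. trace (f x))"
    using assms by (intro sum.cong refl) (auto simp: trace_def)
  finally show ?thesis .
qed

lemma mat_adjoint_mat_sum:
  assumes "\<And>x. x \<in> S \<Longrightarrow> f x \<in> carrier_mat D D"
  shows "mat_adjoint (mat_sum D f S) = mat_sum D (\<lambda>x. mat_adjoint (f x)) S"
proof (intro eq_matI)
  fix i j assume "i < dim_row (mat_sum D (\<lambda>x. mat_adjoint (f x)) S)"
    "j < dim_col (mat_sum D (\<lambda>x. mat_adjoint (f x)) S)"
  then have ij: "i < D" "j < D" by auto
  have "(\<Sum>x\<in>S. cnj (f x $$ (j, i))) = (\<Sum>x\<in>S. mat_adjoint (f x) $$ (i, j))"
  proof (intro sum.cong refl)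
    fix x assume "x \<in> S"
    then have "f x \<in> carrier_mat D D" by (rule assms)
    then show "cnj (f x $$ (j, i)) = mat_adjoint (f x) $$ (i, j)" using ij by simp
  qed
  then show "mat_adjoint (mat_sum D f S) $$ (i, j) = mat_sum D (\<lambda>x. mat_adjoint (f x)) S $$ (i, j)"
    using ij by simp
qed auto

text \<open>This is the squared Frobenius norm. Later equalities of matrices are proved by showing
  that the norm of their difference vanishes.\<close>

lemma trace_mult_adjoint:
  fixes A :: "complex mat"
  assumes "A \<in> carrier_mat m n"
  shows "trace (A * mat_adjoint A) = of_real (\<Sum>i<m. \<Sum>j<n. (cmod (A $$ (i, j)))\<^sup>2)"
proof -
  have "trace (A * mat_adjoint A) = (\<Sum>i<m. \<Sum>j<n. A $$ (i, j) * mat_adjoint A $$ (j, i))"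
    using assms by (intro trace_mult_sum) auto
  also have "\<dots> = of_real (\<Sum>i<m. \<Sum>j<n. (cmod (A $$ (i, j)))\<^sup>2)"
    using assms by (simp add: complex_norm_square[symmetric])
  finally show ?thesis .
qed

text \<open>A sum of squared moduli that is at most zero has only zero terms. An upper bound
  suffices as hypothesis, which suits \<open>psi_eq_stabilizer_average\<close>, where the norm is
  only bounded above.\<close>

lemma trace_mult_adjoint_eq_0D:
  fixes A :: "complex mat"
  assumes "A \<in> carrier_mat m n" "trace (A * mat_adjoint A) \<le> 0"
  shows "A = 0\<^sub>m m n"
proof -
  have s: "(\<Sum>i<m. \<Sum>j<n. (cmod (A $$ (i, j)))\<^sup>2) \<le> 0"
    using assms(2) unfolding trace_mult_adjoint[OF assms(1)] by (simp add: less_eq_complex_def)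
  have "A $$ (i, j) = 0" if "i < m" "j < n" for i j
  proof -
    have "(cmod (A $$ (i, j)))\<^sup>2 \<le> (\<Sum>j<n. (cmod (A $$ (i, j)))\<^sup>2)"
      using that by (intro member_le_sum) auto
    also have "\<dots> \<le> (\<Sum>i<m. \<Sum>j<n. (cmod (A $$ (i, j)))\<^sup>2)"
      using that by (intro member_le_sum[of i _ "\<lambda>i. \<Sum>j<n. (cmod (A $$ (i, j)))\<^sup>2"]) (auto intro!: sum_nonneg)
    finally have "(cmod (A $$ (i, j)))\<^sup>2 \<le> 0" using s by linarith
    then show ?thesis by simp
  qed
  then show ?thesis using assms(1) by (intro eq_matI) auto
qed

text \<open>Division with remainder is the bijection between indices of a Kronecker product and
  pairs of indices of its factors.\<close>

lemma sum_div_mod: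
  fixes f :: "nat \<Rightarrow> nat \<Rightarrow> 'a::comm_monoid_add"
  shows "(\<Sum>k<m * n. f (k div n) (k mod n)) = (\<Sum>a<m. \<Sum>b<n. f a b)"
proof (cases "n = 0")
  case False
  have "(\<Sum>a<m. \<Sum>b<n. f a b) = (\<Sum>(a, b)\<in>{..<m} \<times> {..<n}. f a b)"
    by (simp add: sum.cartesian_product)
  also have "\<dots> = (\<Sum>k<m * n. f (k div n) (k mod n))"
  proof (rule sum.reindex_bij_witness[of _ "\<lambda>k. (k div n, k mod n)" "\<lambda>(a, b). a * n + b"])
    fix x assume "x \<in> {..<m} \<times> {..<n}"
    then obtain a b where x: "x = (a, b)" "a < m" "b < n" by auto
    then have "a * n + b < (a + 1) * n" by simp
    also have "\<dots> \<le> m * n" using x by (intro mult_right_mono) auto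
    finally show "(case x of (a, b) \<Rightarrow> a * n + b) \<in> {..<m * n}" using x by simp
  qed (use False in \<open>auto simp: less_mult_imp_div_less\<close>)
  finally show ?thesis by simp
qed auto

section \<open>Algebra of Kronecker products\<close>

lemma kron_dim [simp]:
  "dim_row (kron A B) = dim_row A * dim_row B" "dim_col (kron A B) = dim_col A * dim_col B"
  by (auto simp: kron_def)

lemma kron_carrier [simp]:
  "A \<in> carrier_mat m n \<Longrightarrow> B \<in> carrier_mat k l \<Longrightarrow> kron A B \<in> carrier_mat (m * k) (n * l)"
  by (auto simp: kron_def)

lemma kron_index [simp]:
  "i < dim_row A * dim_row B \<Longrightarrow> j < dim_col A * dim_col B \<Longrightarrow>
   kron A B $$ (i, j) = A $$ (i div dim_row B, j div dim_col B) * B $$ (i mod dim_row B, j mod dim_col B)"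
  by (simp add: kron_def)

lemma mod_less_mult: "i < m * n \<Longrightarrow> i mod n < (n::nat)"
  by (cases n) auto

lemmas div_mod_less = less_mult_imp_div_less mod_less_mult

lemma kron_mult:
  assumes "A \<in> carrier_mat a b" "C \<in> carrier_mat b c" "B \<in> carrier_mat a' b'" "D \<in> carrier_mat b' c'"
  shows "kron A B * kron C D = kron (A * C) (B * D)"
proof (intro eq_matI)
  fix i j assume "i < dim_row (kron (A * C) (B * D))" "j < dim_col (kron (A * C) (B * D))"
  then have ij: "i < a * a'" "j < c * c'" using assms by auto
  have "(kron A B * kron C D) $$ (i, j) = (\<Sum>k<b * b'. A $$ (i div a', k div b') * B $$ (i mod a', k mod b')
     * (C $$ (k div b', j div c') * D $$ (k mod b', j mod c')))"
    using ij assms by (simp add: scalar_prod_def atLeast0LessThan div_mod_less)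
  also have "\<dots> = (\<Sum>k<b. \<Sum>l<b'. A $$ (i div a', k) * B $$ (i mod a', l) * (C $$ (k, j div c') * D $$ (l, j mod c')))"
    by (rule sum_div_mod)
  also have "\<dots> = (\<Sum>k<b. A $$ (i div a', k) * C $$ (k, j div c')) * (\<Sum>l<b'. B $$ (i mod a', l) * D $$ (l, j mod c'))"
    by (simp add: sum_product mult_ac)
  also have "\<dots> = kron (A * C) (B * D) $$ (i, j)"
    using ij assms by (simp add: scalar_prod_def atLeast0LessThan div_mod_less)
  finally show "(kron A B * kron C D) $$ (i, j) = kron (A * C) (B * D) $$ (i, j)" .
qed (use assms in auto)

lemma trace_kron:
  assumes "A \<in> carrier_mat m m" "B \<in> carrier_mat n n"
  shows "trace (kron A B) = trace A * trace B"
proof -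
  have "trace (kron A B) = (\<Sum>k<m * n. A $$ (k div n, k div n) * B $$ (k mod n, k mod n))"
    using assms by (simp add: trace_def div_mod_less)
  also have "\<dots> = (\<Sum>a<m. \<Sum>b<n. A $$ (a, a) * B $$ (b, b))" by (rule sum_div_mod)
  also have "\<dots> = trace A * trace B" using assms by (simp add: trace_def sum_product)
  finally show ?thesis .
qed

lemma kron_adjoint: "mat_adjoint (kron A B) = kron (mat_adjoint A) (mat_adjoint B)"
  by (intro eq_matI) (auto simp: div_mod_less)

lemma kron_one: "kron (1\<^sub>m m) (1\<^sub>m n) = 1\<^sub>m (m * n)"
proof (intro eq_matI)
  fix i j assume "i < dim_row (1\<^sub>m (m * n) :: complex mat)" "j < dim_col (1\<^sub>m (m * n) :: complex mat)"
  moreover have "i = j \<longleftrightarrow> i div n = j div n \<and> i mod n = j mod n"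
    by (metis div_mult_mod_eq)
  ultimately show "kron (1\<^sub>m m) (1\<^sub>m n) $$ (i, j) = 1\<^sub>m (m * n) $$ (i, j)"
    by (auto simp: div_mod_less)
qed auto

lemma kron_smult_left: "kron (c \<cdot>\<^sub>m A) B = c \<cdot>\<^sub>m kron A B"
  by (intro eq_matI) (auto simp: div_mod_less)

lemma kron_smult_right: "kron A (c \<cdot>\<^sub>m B) = c \<cdot>\<^sub>m kron A B"
  by (intro eq_matI) (auto simp: div_mod_less)

lemma kron_add_left:
  assumes "A \<in> carrier_mat m n" "A' \<in> carrier_mat m n"
  shows "kron (A + A') B = kron A B + kron A' B"
  using assms by (intro eq_matI) (auto simp: div_mod_less distrib_right)

lemma kron_add_right:
  assumes "B \<in> carrier_mat m n" "B' \<in> carrier_mat m n"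
  shows "kron A (B + B') = kron A B + kron A B'"
  using assms by (intro eq_matI) (auto simp: div_mod_less distrib_left)

lemma kron_zero_left: "kron (0\<^sub>m m n) B = 0\<^sub>m (m * dim_row B) (n * dim_col B)"
  by (intro eq_matI) (auto simp: div_mod_less)

lemma kron_zero_right: "kron A (0\<^sub>m m n) = 0\<^sub>m (dim_row A * m) (dim_col A * n)"
  by (intro eq_matI) (auto simp: div_mod_less)

lemma kron_assoc: "kron (kron A B) C = kron A (kron B C)"
proof (intro eq_matI)
  fix i j assume "i < dim_row (kron A (kron B C))" "j < dim_col (kron A (kron B C))"
  then have ij: "i < dim_row A * dim_row B * dim_row C" "j < dim_col A * dim_col B * dim_col C"
    by (auto simp: mult.assoc)
  have d1: "a div n div m = a div (m * n)" for a m n :: nat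
    by (simp add: div_mult2_eq mult.commute[of m n])
  have d2: "a mod (m * n) div n = a div n mod m" for a m n :: nat
    by (cases "n = 0") (simp_all add: mult.commute[of m n] mod_mult2_eq)
  have d3: "a mod (m * n) mod n = a mod n" for a m n :: nat
    by (simp add: mod_mod_cancel)
  have i: "i div dim_row C < dim_row A * dim_row B" "i mod dim_row C < dim_row C"
    "j div dim_col C < dim_col A * dim_col B" "j mod dim_col C < dim_col C"
    "i div (dim_row B * dim_row C) < dim_row A" "i mod (dim_row B * dim_row C) < dim_row B * dim_row C"
    "j div (dim_col B * dim_col C) < dim_col A" "j mod (dim_col B * dim_col C) < dim_col B * dim_col C"
    using ij by (auto intro!: div_mod_less simp flip: mult.assoc)
  have "kron (kron A B) C $$ (i, j) =
    A $$ (i div (dim_row B * dim_row C), j div (dim_col B * dim_col C)) *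
    B $$ (i div dim_row C mod dim_row B, j div dim_col C mod dim_col B) * C $$ (i mod dim_row C, j mod dim_col C)"
    using ij i by (simp add: d1)
  also have "\<dots> = kron A (kron B C) $$ (i, j)"
    using ij i by (simp add: d2 d3 mult.assoc)
  finally show "kron (kron A B) C $$ (i, j) = kron A (kron B C) $$ (i, j)" .
qed (auto simp: mult.assoc)

lemma kron_one_left: "kron (1\<^sub>m 1) B = B"
  by (intro eq_matI) auto

lemma tensor_list_append: "tensor_list (xs @ ys) = kron (tensor_list xs) (tensor_list ys)"
  by (induction xs) (simp_all add: tensor_list_def kron_one_left[simplified] kron_assoc)

section \<open>Weyl operators in a single odd dimension\<close>

text \<open>The standard additive character modulo \<open>p\<close>. Integer arguments make
  differences and negatives of exponents available without truncation.\<close>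

definition root_char :: "nat \<Rightarrow> int \<Rightarrow> complex" where
  "root_char p x = cis (2 * pi * real_of_int x / real p)"

lemma smult_mat_one [simp]: "1 \<cdot>\<^sub>m A = (A :: complex mat)"
  by (intro eq_matI) auto

lemma smult_smult_mat: "c \<cdot>\<^sub>m (c' \<cdot>\<^sub>m A) = (c * c') \<cdot>\<^sub>m (A :: complex mat)"
  by (intro eq_matI) auto

lemma root_char_zero [simp]: "root_char p 0 = 1"
  by (simp add: root_char_def)

lemma root_char_add: "root_char p (x + y) = root_char p x * root_char p y"
  by (simp add: root_char_def cis_mult distrib_left add_divide_distrib)

lemma cnj_root_char: "cnj (root_char p x) = root_char p (- x)"
  by (simp add: root_char_def cis_cnj)

lemma cmod_root_char [simp]: "cmod (root_char p x) = 1"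
  by (simp add: root_char_def)

lemma root_char_eq_1_iff:
  assumes "p > 0"
  shows "root_char p x = 1 \<longleftrightarrow> int p dvd x"
proof
  assume "root_char p x = 1"
  then have "cos (2 * pi * real_of_int x / real p) = 1"
    by (simp add: root_char_def complex_eq_iff)
  then obtain n :: int where "2 * pi * real_of_int x / real p = n * 2 * pi"
    by (auto simp: cos_one_2pi_int)
  then have "real_of_int x = real_of_int (n * int p)"
    using assms by (simp add: field_simps)
  then have "x = n * int p" by (simp only: of_int_eq_iff)
  then show "int p dvd x" by simp
next
  assume "int p dvd x"
  then obtain k where "x = int p * k" by (rule dvdE)
  then have "2 * pi * real_of_int x / real p = 2 * pi * of_int k" using assms by simp
  then show "root_char p x = 1" by (simp only: root_char_def cis_multiple_2pi Ints_of_int)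
qed

lemma root_char_cong:
  assumes "p > 0" "int p dvd x - y"
  shows "root_char p x = root_char p y"
  using root_char_add[of p "x - y" y] root_char_eq_1_iff[of p "x - y"] assms by simp

text \<open>Orthogonality of characters: a nontrivial character is a geometric sequence whose ratio
  is a root of unity other than 1, so its sum over a period vanishes.\<close>

lemma sum_root_char:
  assumes "p > 0"
  shows "(\<Sum>i<p. root_char p (a * int i + c)) = (if int p dvd a then of_nat p * root_char p c else 0)"
proof -
  have pow: "root_char p (a * int i) = root_char p a ^ i" for i
    by (induction i) (simp_all add: distrib_left root_char_add)
  have "(\<Sum>i<p. root_char p a ^ i) = (if int p dvd a then of_nat p else 0)"
  proof (cases "int p dvd a")
    case True
    then show ?thesis using root_char_eq_1_iff[of p a] assms by simp
  next
    case False
    then have ne: "root_char p a \<noteq> 1" using root_char_eq_1_iff assms by simp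
    have "root_char p a ^ p = 1"
      using pow[of p] root_char_eq_1_iff[OF assms, of "a * int p"] by simp
    then show ?thesis using False ne by (simp add: geometric_sum)
  qed
  then show ?thesis
    by (auto simp: root_char_add pow simp flip: sum_distrib_right)
qed

lemma residue_properties:
  fixes x :: int
  assumes "p > 0"
  shows "nat (x mod int p) < p" "int p dvd int (nat (x mod int p)) - x"
proof -
  have "int (nat (x mod int p)) = x mod int p" using assms by simp
  moreover have "x mod int p < int p" using assms by simp
  moreover have "int p dvd x mod int p - x" unfolding mod_eq_dvd_iff[symmetric] by simp
  ultimately show "nat (x mod int p) < p" "int p dvd int (nat (x mod int p)) - x" by (linarith, simp only:)
qed

lemma residue_unique:
  assumes "k < p" "l < p" "int p dvd int k - int l"
  shows "k = l"
  using assms by (metis mod_eq_dvd_iff mod_pos_pos_trivial nat_int of_nat_0_le_iff of_nat_less_iff)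

text \<open>Each row of the Weyl and phase-point matrices has a single nonzero entry, so a matrix
  product collapses to one summand, at the representative of a residue class.\<close>

lemma sum_residue:
  assumes "p > 0" "\<And>k. k < p \<Longrightarrow> \<not> int p dvd int k - x \<Longrightarrow> F k = 0"
  shows "(\<Sum>k<p. F k) = (F (nat (x mod int p)) :: 'a::comm_monoid_add)"
proof -
  let ?k = "nat (x mod int p)"
  note k = residue_properties[OF assms(1), of x]
  have "(\<Sum>k<p. F k) = (\<Sum>k\<in>{?k}. F k)"
  proof (rule sum.mono_neutral_right)
    show "\<forall>l\<in>{..<p} - {?k}. F l = 0"
    proof
      fix l assume l: "l \<in> {..<p} - {?k}"
      have "\<not> int p dvd int l - x"
      proof
        assume "int p dvd int l - x"
        then have "int p dvd (int l - x) - (int ?k - x)" using k(2) by (rule dvd_diff)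
        then have "int p dvd int l - int ?k" by simp
        then show False using residue_unique[of l p ?k] l k(1) by simp
      qed
      then show "F l = 0" using assms(2) l by simp
    qed
  qed (use k in auto)
  then show ?thesis by simp
qed

section \<open>Weyl operators without the normalizing phase\<close>

text \<open>The matrix of $Z^a X^b$ with integer exponents: column \<open>j\<close> has its entry in
  row \<open>j + b\<close> modulo \<open>p\<close>. Inverses are then obtained by negating
  exponents.\<close>

definition weyl :: "nat \<Rightarrow> int \<Rightarrow> int \<Rightarrow> complex mat" where
  "weyl p a b = mat p p (\<lambda>(i, j). if int p dvd int i - int j - b then root_char p (a * int i) else 0)"

lemma weyl_carrier [simp]: "weyl p a b \<in> carrier_mat p p"
  "dim_row (weyl p a b) = p" "dim_col (weyl p a b) = p"
  by (auto simp: weyl_def)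

lemma weyl_index [simp]: "i < p \<Longrightarrow> j < p \<Longrightarrow>
  weyl p a b $$ (i, j) = (if int p dvd int i - int j - b then root_char p (a * int i) else 0)"
  by (simp add: weyl_def)

lemma weyl_cong:
  assumes "p > 0" "int p dvd a - a'" "int p dvd b - b'"
  shows "weyl p a b = weyl p a' b'"
proof (intro eq_matI)
  fix i j assume "i < dim_row (weyl p a' b')" "j < dim_col (weyl p a' b')"
  moreover have "int p dvd int i - int j - b \<longleftrightarrow> int p dvd int i - int j - b'"
    using dvd_add_right_iff[OF assms(3), of "int i - int j - b"] by simp
  moreover have "root_char p (a * int i) = root_char p (a' * int i)"
    using assms by (intro root_char_cong) (simp_all flip: left_diff_distrib)
  ultimately show "weyl p a b $$ (i, j) = weyl p a' b' $$ (i, j)" by simp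
qed auto

lemma weyl_zero: "weyl p 0 0 = 1\<^sub>m p"
  by (intro eq_matI) (auto dest: residue_unique)

text \<open>The phase comes from moving $X^b$ past $Z^{a'}$, which costs the factor
  \<open>root_char p (- (a' * b))\<close>.\<close>

lemma weyl_mult:
  assumes "p > 0"
  shows "weyl p a b * weyl p a' b' = root_char p (- (a' * b)) \<cdot>\<^sub>m weyl p (a + a') (b + b')"
proof (intro eq_matI)
  fix i j assume "i < dim_row (root_char p (- (a' * b)) \<cdot>\<^sub>m weyl p (a + a') (b + b'))"
    "j < dim_col (root_char p (- (a' * b)) \<cdot>\<^sub>m weyl p (a + a') (b + b'))"
  then have ij: "i < p" "j < p" by auto
  \<comment> \<open>The only column in which row \<open>i\<close> of the left factor is
    nonzero.\<close>
  define m where "m = nat ((int i - b) mod int p)"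
  have k: "m < p" "int p dvd int m - (int i - b)"
    unfolding m_def by (rule residue_properties[OF assms])+
  have 0: "int p dvd int i - k - b \<longleftrightarrow> int p dvd k - (int i - b)" for k
  proof -
    have "k - (int i - b) = - (int i - k - b)" by simp
    then show ?thesis by (simp only: dvd_minus_iff)
  qed
  have 1: "int p dvd int i - int m - b"
    using k(2) by (simp only: 0)
  have 2: "int p dvd int m - int j - b' \<longleftrightarrow> int p dvd int i - int j - (b + b')"
    using dvd_add_right_iff[OF 1, of "int m - int j - b'"] by (simp add: algebra_simps)
  have 3: "root_char p (a' * int m) = root_char p (a' * int i - a' * b)"
    using k(2) assms
    by (intro root_char_cong) (simp_all flip: right_diff_distrib)
  have "(weyl p a b * weyl p a' b') $$ (i, j) = (\<Sum>k<p. weyl p a b $$ (i, k) * weyl p a' b' $$ (k, j))"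
    using ij by (simp add: scalar_prod_def atLeast0LessThan)
  also have "\<dots> = weyl p a b $$ (i, m) * weyl p a' b' $$ (m, j)"
    unfolding m_def using ij by (intro sum_residue assms) (simp add: 0)
  also have "\<dots> = (if int p dvd int i - int j - (b + b')
    then root_char p (a * int i) * root_char p (a' * int i - a' * b) else 0)"
    using ij k(1) 1 by (simp only: weyl_index 2 3 if_True) simp
  also have "\<dots> = (root_char p (- (a' * b)) \<cdot>\<^sub>m weyl p (a + a') (b + b')) $$ (i, j)"
    using ij by (simp flip: root_char_add) (simp add: algebra_simps)
  finally show "(weyl p a b * weyl p a' b') $$ (i, j) =
    (root_char p (- (a' * b)) \<cdot>\<^sub>m weyl p (a + a') (b + b')) $$ (i, j)" .
qed auto

lemma weyl_adjoint:
  assumes "p > 0"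
  shows "mat_adjoint (weyl p a b) = root_char p (- (a * b)) \<cdot>\<^sub>m weyl p (- a) (- b)"
proof (intro eq_matI)
  fix i j assume "i < dim_row (root_char p (- (a * b)) \<cdot>\<^sub>m weyl p (- a) (- b))"
    "j < dim_col (root_char p (- (a * b)) \<cdot>\<^sub>m weyl p (- a) (- b))"
  then have ij: "i < p" "j < p" by auto
  have 1: "int p dvd int j - int i - b \<longleftrightarrow> int p dvd int i - int j + b"
    using dvd_minus_iff[of "int p" "int j - int i - b"] by (simp add: algebra_simps)
  have 2: "root_char p (- (a * int j)) = root_char p (- (a * b)) * root_char p (- (a * int i))"
    if "int p dvd int i - int j + b"
  proof -
    have "- (a * int j) - (- (a * b) + - (a * int i)) = a * (int i - int j + b)"
      by (simp add: algebra_simps)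
    then show ?thesis
      unfolding root_char_add[symmetric] using that assms by (intro root_char_cong) auto
  qed
  show "mat_adjoint (weyl p a b) $$ (i, j) = (root_char p (- (a * b)) \<cdot>\<^sub>m weyl p (- a) (- b)) $$ (i, j)"
    using ij 2 by (simp add: 1 cnj_root_char)
qed auto

lemma trace_weyl:
  assumes "p > 0"
  shows "trace (weyl p a b) = (if int p dvd a \<and> int p dvd b then of_nat p else 0)"
  using sum_root_char[OF assms, of a 0] by (cases "int p dvd b") (auto simp: trace_def)

lemma clock_op_power: "p > 0 \<Longrightarrow> clock_op p ^\<^sub>m a = weyl p (int a) 0"
proof (induction a)
  case 0
  then show ?case by (simp add: weyl_zero clock_op_def)
next
  case (Suc a)
  have "clock_op p = weyl p 1 0"
    by (intro eq_matI) (auto simp: clock_op_def root_char_def dest: residue_unique)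
  with Suc show ?case by (simp add: weyl_mult add.commute)
qed

lemma shift_op_power: "p > 0 \<Longrightarrow> shift_op p ^\<^sub>m a = weyl p 0 (int a)"
proof (induction a)
  case 0
  then show ?case by (simp add: weyl_zero shift_op_def)
next
  case (Suc a)
  have "i = (j + 1) mod p \<longleftrightarrow> int p dvd int i - int j - 1" if "i < p" "j < p" for i j
  proof -
    have "i = (j + 1) mod p \<longleftrightarrow> int i mod int p = (int j + 1) mod int p"
      using that by (metis int_ops(4) Suc_eq_plus1 add.commute mod_less of_nat_Suc of_nat_eq_iff zmod_int)
    then show ?thesis by (simp add: mod_eq_dvd_iff diff_diff_eq)
  qed
  then have "shift_op p = weyl p 0 1"
    by (intro eq_matI) (auto simp: shift_op_def)
  with Suc show ?case by (simp add: weyl_mult add.commute)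
qed

lemma heisenberg_weyl1_eq:
  assumes "p > 0"
  shows "heisenberg_weyl1 p (a, b) =
    cis (- ((real p + 1) * pi * real a * real b / real p)) \<cdot>\<^sub>m weyl p (int a) (int b)"
  using assms by (simp add: heisenberg_weyl1_def clock_op_power shift_op_power weyl_mult)

text \<open>For odd \<open>p\<close>, halving modulo \<open>p\<close> is multiplication by \<open>(p + 1) / 2\<close>, and the phase in front
  of $Z^{a_1} X^{a_2}$ becomes a $p$-th root of unity.\<close>

lemma heisenberg_weyl1_phase:
  assumes "p > 0" "odd p"
  shows "cis (- ((real p + 1) * pi * real a * real b / real p)) =
    root_char p (- (int ((p + 1) div 2) * int a * int b))"
proof -
  have "2 * real ((p + 1) div 2) = real p + 1"
    using assms(2) by (auto elim!: oddE)
  then have "2 * pi * real_of_int (- (int ((p + 1) div 2) * int a * int b)) / real p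
    = - ((real p + 1) * pi * real a * real b / real p)"
    by (simp flip: \<open>2 * _ = real p + 1\<close>)
  then show ?thesis by (simp only: root_char_def)
qed

section \<open>Phase-point operators as reflections\<close>

text \<open>The operator at the origin is the parity operator, sending basis vector \<open>j\<close>
  to \<open>-j\<close>. In a fixed entry only shifts \<open>b\<close> congruent to
  \<open>i - j\<close> contribute, and the character sum over \<open>a\<close> then leaves the
  condition that \<open>i\<close> is half of \<open>b\<close> modulo \<open>p\<close>.\<close>

lemma phase_point_zero_eq:
  assumes "p > 0" "odd p"
  shows "phase_point_zero p = mat p p (\<lambda>(i, j). if int p dvd int i + int j then 1 else 0)" (is "_ = ?P")
proof (intro eq_matI)
  fix i j assume "i < dim_row ?P" "j < dim_col ?P"
  then have ij: "i < p" "j < p" by auto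
  \<comment> \<open>The inverse of 2 modulo the odd number \<open>p\<close>.\<close>
  define h where "h = int ((p + 1) div 2)"
  let ?b = "nat ((int i - int j) mod int p)"
  note b = residue_properties[OF assms(1), of "int i - int j"]
  have h: "2 * h = int p + 1" using assms(2) by (auto elim!: oddE simp: h_def)
  \<comment> \<open>Doubling is invertible modulo \<open>p\<close> and turns
    \<open>i - h * b\<close>, with \<open>b\<close> congruent to \<open>i - j\<close>, into
    \<open>i + j\<close>.\<close>
  have e: "int p dvd int i - h * int ?b \<longleftrightarrow> int p dvd int i + int j"
  proof -
    have "int p dvd int i - h * int ?b \<longleftrightarrow> int p dvd 2 * (int i - h * int ?b)"
      using assms(2) by (intro coprime_dvd_mult_right_iff[symmetric]) auto
    also have "2 * (int i - h * int ?b) =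
      (int i + int j) - (int p * int ?b + (int ?b - (int i - int j)))"
      unfolding right_diff_distrib mult.assoc[symmetric] h by (simp add: algebra_simps)
    also have "int p dvd \<dots> \<longleftrightarrow> int p dvd int i + int j"
      using dvd_add_left_iff[OF dvd_add[OF dvd_triv_left[of "int p" "int ?b"] b(2)], of "int i + int j - (int p * int ?b + (int ?b - (int i - int j)))"]
      by (simp only: diff_add_cancel)
    finally show ?thesis .
  qed
  have "(\<Sum>x\<in>point_set p. heisenberg_weyl1 p x $$ (i, j)) =
    (\<Sum>b<p. \<Sum>a<p. heisenberg_weyl1 p (a, b) $$ (i, j))"
    unfolding point_set_def by (subst sum.swap) (simp add: sum.cartesian_product)
  \<comment> \<open>The added \<open>0\<close> gives the exponent the shape expected by
    \<open>sum_root_char\<close>.\<close>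
  also have "\<dots> = (\<Sum>b<p. if int p dvd int b - (int i - int j)
    then \<Sum>a<p. root_char p ((int i - h * int b) * int a + 0) else 0)"
  proof (intro sum.cong refl)
    fix b
    have 1: "int p dvd int i - int j - int b \<longleftrightarrow> int p dvd int b - (int i - int j)"
      by (rule dvd_diff_commute)
    have 2: "root_char p (- (h * int a * int b)) * root_char p (int a * int i)
      = root_char p ((int i - h * int b) * int a + 0)" for a
      by (simp flip: root_char_add) (simp add: algebra_simps)
    have "heisenberg_weyl1 p (a, b) $$ (i, j) = (if int p dvd int b - (int i - int j)
      then root_char p ((int i - h * int b) * int a + 0) else 0)" for a
      unfolding heisenberg_weyl1_eq[OF assms(1)] heisenberg_weyl1_phase[OF assms] h_def[symmetric]
      using ij by (simp add: 1 2 del: minus_mult_left add_0_right)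
    then show "(\<Sum>a<p. heisenberg_weyl1 p (a, b) $$ (i, j)) = (if int p dvd int b - (int i - int j)
      then \<Sum>a<p. root_char p ((int i - h * int b) * int a + 0) else 0)"
      by simp
  qed
  also have "\<dots> = (\<Sum>a<p. root_char p ((int i - h * int ?b) * int a + 0))"
    using b(2) assms(1) by (subst sum_residue[where x = "int i - int j"]) auto
  also have "\<dots> = (if int p dvd int i + int j then of_nat p else 0)"
    unfolding sum_root_char[OF assms(1)] e by simp
  finally show "phase_point_zero p $$ (i, j) = ?P $$ (i, j)"
    using ij assms(1) by (auto simp: phase_point_zero_def)
qed (auto simp: phase_point_zero_def)

lemma heisenberg_weyl1_carrier [simp]: "heisenberg_weyl1 p u \<in> carrier_mat p p"
  by (cases u) (auto simp: heisenberg_weyl1_def clock_op_def shift_op_def intro!: mult_carrier_mat pow_carrier_mat)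

lemma phase_point1_carrier [simp]: "phase_point1 p u \<in> carrier_mat p p"
  by (auto simp: phase_point1_def phase_point_zero_def intro!: mult_carrier_mat)

lemma odd_dvd_double_iff: "odd p \<Longrightarrow> int p dvd 2 * x \<longleftrightarrow> int p dvd x"
  by (intro coprime_dvd_mult_right_iff) auto

text \<open>Conjugating parity by a translation gives the reflection of \<open>j\<close> to
  \<open>2 * b - j\<close>, decorated with a phase. All later facts about a single factor are read
  off from these entries.\<close>

lemma phase_point1_eq:
  assumes "p > 0" "odd p"
  shows "phase_point1 p (a, b) = mat p p (\<lambda>(i, j). if int p dvd int i + int j - 2 * int b
    then root_char p (int a * (int i - int j)) else 0)" (is "_ = ?A")
proof -
  let ?W = "weyl p (int a) (int b)"
  let ?WP = "mat p p (\<lambda>(i, k). if int p dvd int i + int k - int b then root_char p (int a * int i) else 0)"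
  \<comment> \<open>The normalizing phase of the Weyl operator meets its conjugate and cancels, so
    its value need not be tracked.\<close>
  obtain c where c: "heisenberg_weyl1 p (a, b) = c \<cdot>\<^sub>m ?W" "cmod c = 1"
    using heisenberg_weyl1_eq[OF assms(1)] by auto
  have cc: "c * cnj c = 1" using c(2) by (metis complex_norm_square of_real_1 one_power2)
  have WP: "?W * phase_point_zero p = ?WP"
  proof (intro eq_matI)
    fix i k assume "i < dim_row ?WP" "k < dim_col ?WP"
    then have ij: "i < p" "k < p" by auto
    define m where "m = nat ((int i - int b) mod int p)"
    have m: "m < p" "int p dvd int m - (int i - int b)"
      unfolding m_def by (rule residue_properties[OF assms(1)])+
    have 0: "int p dvd int i - l - int b \<longleftrightarrow> int p dvd l - (int i - int b)" for l
      using dvd_diff_commute[of "int p" l "int i - int b"] by (simp add: algebra_simps)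
    have 1: "int p dvd int m + int k \<longleftrightarrow> int p dvd int i + int k - int b"
      using dvd_add_right_iff[OF m(2), of "int i + int k - int b"] by simp
    have "(?W * phase_point_zero p) $$ (i, k) = (\<Sum>l<p. ?W $$ (i, l) * phase_point_zero p $$ (l, k))"
      using ij by (simp add: scalar_prod_def atLeast0LessThan phase_point_zero_eq[OF assms])
    also have "\<dots> = ?W $$ (i, m) * phase_point_zero p $$ (m, k)"
      unfolding m_def using ij by (intro sum_residue assms) (simp add: 0)
    also have "\<dots> = ?WP $$ (i, k)"
      using ij m 0[of "int m"] by (simp add: phase_point_zero_eq[OF assms] 1)
    finally show "(?W * phase_point_zero p) $$ (i, k) = ?WP $$ (i, k)" .
  qed (auto simp: phase_point_zero_eq[OF assms])
  have "phase_point1 p (a, b) = (c \<cdot>\<^sub>m ?W) * phase_point_zero p * (cnj c \<cdot>\<^sub>m mat_adjoint ?W)"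
    by (simp add: phase_point1_def c mat_adjoint_smult)
  also have "\<dots> = (c * cnj c) \<cdot>\<^sub>m (?W * phase_point_zero p * mat_adjoint ?W)"
  proof -
    have P: "phase_point_zero p \<in> carrier_mat p p" by (simp add: phase_point_zero_eq[OF assms])
    have "(c \<cdot>\<^sub>m ?W) * phase_point_zero p = c \<cdot>\<^sub>m (?W * phase_point_zero p)"
      by (rule mult_smult_assoc_mat[OF weyl_carrier(1) P])
    moreover have "(c \<cdot>\<^sub>m (?W * phase_point_zero p)) * (cnj c \<cdot>\<^sub>m mat_adjoint ?W)
      = c \<cdot>\<^sub>m (cnj c \<cdot>\<^sub>m (?W * phase_point_zero p * mat_adjoint ?W))"
      using P mult_smult_assoc_mat[of "?W * phase_point_zero p" p p "cnj c \<cdot>\<^sub>m mat_adjoint ?W" p c]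
        mult_smult_distrib[of "?W * phase_point_zero p" p p "mat_adjoint ?W" p "cnj c"]
      by (metis mult_carrier_mat mat_adjoint_carrier smult_carrier_mat weyl_carrier(1))
    ultimately show ?thesis by (simp only: smult_smult_mat)
  qed
  also have "\<dots> = ?WP * mat_adjoint ?W" by (simp add: cc WP)
  also have "\<dots> = ?A"
  proof (intro eq_matI)
    fix i j assume "i < dim_row ?A" "j < dim_col ?A"
    then have ij: "i < p" "j < p" by auto
    define m where "m = nat ((int j - int b) mod int p)"
    have m: "m < p" "int p dvd int m - (int j - int b)"
      unfolding m_def by (rule residue_properties[OF assms(1)])+
    have 0: "int p dvd int j - l - int b \<longleftrightarrow> int p dvd l - (int j - int b)" for l
      using dvd_diff_commute[of "int p" l "int j - int b"] by (simp add: algebra_simps)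
    have 1: "int p dvd int i + int m - int b \<longleftrightarrow> int p dvd int i + int j - 2 * int b"
      using dvd_add_right_iff[OF m(2), of "int i + int j - 2 * int b"] by (simp add: algebra_simps)
    have "(?WP * mat_adjoint ?W) $$ (i, j) = (\<Sum>l<p. ?WP $$ (i, l) * mat_adjoint ?W $$ (l, j))"
      using ij by (simp add: scalar_prod_def atLeast0LessThan)
    also have "\<dots> = ?WP $$ (i, m) * mat_adjoint ?W $$ (m, j)"
      unfolding m_def using ij by (intro sum_residue assms) (simp add: 0)
    also have "\<dots> = (if int p dvd int i + int j - 2 * int b
      then root_char p (int a * int i) * root_char p (- (int a * int j)) else 0)"
      using ij m 0[of "int m"] by (simp add: 1 cnj_root_char)
    also have "\<dots> = ?A $$ (i, j)"
      using ij by (simp flip: root_char_add) (simp add: algebra_simps)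
    finally show "(?WP * mat_adjoint ?W) $$ (i, j) = ?A $$ (i, j)" .
  qed auto
  finally show ?thesis .
qed

lemma phase_point1_index:
  assumes "p > 0" "odd p" "i < p" "j < p"
  shows "phase_point1 p (a, b) $$ (i, j) = (if int p dvd int i + int j - 2 * int b
    then root_char p (int a * (int i - int j)) else 0)"
  using assms by (simp add: phase_point1_eq)

lemma phase_point1_dim [simp]: "dim_row (phase_point1 p u) = p" "dim_col (phase_point1 p u) = p"
  using carrier_matD[OF phase_point1_carrier] by auto

lemma phase_point1_adjoint:
  assumes "p > 0" "odd p"
  shows "mat_adjoint (phase_point1 p u) = phase_point1 p u"
proof (cases u)
  case (Pair a b)
  show ?thesis
    unfolding Pair
    by (intro eq_matI)
      (auto simp: phase_point1_index assms cnj_root_char add.commute simp flip: mult_minus_right)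
qed

text \<open>Two reflections compose to a translation by twice the difference of their centres, hence
  to a Weyl operator up to phase. This is what links phase points to stabilizers.\<close>

lemma phase_point1_mult:
  assumes "p > 0" "odd p"
  shows "phase_point1 p (a, b) * phase_point1 p (a', b') =
    root_char p (int a' * (4 * int b - 2 * int b') - 2 * int a * int b) \<cdot>\<^sub>m
      weyl p (2 * (int a - int a')) (2 * (int b - int b'))" (is "_ = ?c \<cdot>\<^sub>m ?W")
proof (intro eq_matI)
  fix i j assume "i < dim_row (?c \<cdot>\<^sub>m ?W)" "j < dim_col (?c \<cdot>\<^sub>m ?W)"
  then have ij: "i < p" "j < p" by auto
  define m where "m = nat ((2 * int b - int i) mod int p)"
  have m: "m < p" "int p dvd int m - (2 * int b - int i)"
    unfolding m_def by (rule residue_properties[OF assms(1)])+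
  have 0: "int i + l - 2 * int b = l - (2 * int b - int i)" for l
    by (simp add: algebra_simps)
  have 1: "int p dvd int m + int j - 2 * int b' \<longleftrightarrow> int p dvd int i - int j - 2 * (int b - int b')"
    using dvd_diff_right_iff[OF m(2), of "int m + int j - 2 * int b'"]
      dvd_diff_commute[of "int p" "int m - (2 * int b - int i)" "int m + int j - 2 * int b'"]
    by (simp add: algebra_simps)
  have 2: "root_char p (int a * (int i - int m) + int a' * (int m - int j)) =
      root_char p (int a' * (4 * int b - 2 * int b') - 2 * int a * int b + 2 * (int a - int a') * int i)"
    if d: "int p dvd int i - int j - 2 * (int b - int b')"
  proof (rule root_char_cong[OF assms(1)])
    have "int a * (int i - int m) + int a' * (int m - int j) -
      (int a' * (4 * int b - 2 * int b') - 2 * int a * int b + 2 * (int a - int a') * int i)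
      = (int a' - int a) * (int m - (2 * int b - int i)) + int a' * (int i - int j - 2 * (int b - int b'))"
      by (simp add: algebra_simps)
    then show "int p dvd int a * (int i - int m) + int a' * (int m - int j) -
      (int a' * (4 * int b - 2 * int b') - 2 * int a * int b + 2 * (int a - int a') * int i)"
      using m(2) d by (simp only:) (intro dvd_add dvd_mult)
  qed
  have "(phase_point1 p (a, b) * phase_point1 p (a', b')) $$ (i, j)
    = (\<Sum>l<p. phase_point1 p (a, b) $$ (i, l) * phase_point1 p (a', b') $$ (l, j))"
    using ij by (simp add: scalar_prod_def atLeast0LessThan)
  also have "\<dots> = phase_point1 p (a, b) $$ (i, m) * phase_point1 p (a', b') $$ (m, j)"
    unfolding m_def using ij by (intro sum_residue assms) (simp only: phase_point1_index[OF assms] 0 if_False mult_zero_left)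
  also have "\<dots> = (if int p dvd int i - int j - 2 * (int b - int b')
      then root_char p (int a * (int i - int m) + int a' * (int m - int j)) else 0)"
    using ij m by (simp only: phase_point1_index[OF assms] 0 1 if_True) (simp add: root_char_add)
  also have "\<dots> = (?c \<cdot>\<^sub>m ?W) $$ (i, j)"
    using ij 2 by (simp flip: root_char_add)
  finally show "(phase_point1 p (a, b) * phase_point1 p (a', b')) $$ (i, j) = (?c \<cdot>\<^sub>m ?W) $$ (i, j)" .
qed (auto simp: phase_point1_eq assms)

lemma phase_point1_square:
  assumes "p > 0" "odd p"
  shows "phase_point1 p u * phase_point1 p u = 1\<^sub>m p"
  by (cases u) (simp add: phase_point1_mult[OF assms] weyl_zero algebra_simps)

text \<open>For odd \<open>p\<close> the reflection about \<open>b\<close> fixes exactly one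
  residue, namely \<open>b\<close>, and the phase on the diagonal is 1.\<close>

lemma trace_phase_point1:
  assumes "p > 0" "odd p"
  shows "trace (phase_point1 p u) = 1"
proof (cases u)
  case (Pair a b)
  define m where "m = nat (int b mod int p)"
  have m: "m < p" "int p dvd int m - int b"
    unfolding m_def by (rule residue_properties[OF assms(1)])+
  have 0: "int p dvd int i + int i - 2 * int b \<longleftrightarrow> int p dvd int i - int b" for i
    using odd_dvd_double_iff[OF assms(2), of "int i - int b"] by (simp add: algebra_simps)
  have "trace (phase_point1 p u) = (\<Sum>i<p. phase_point1 p (a, b) $$ (i, i))"
    by (simp add: trace_def Pair)
  also have "\<dots> = phase_point1 p (a, b) $$ (m, m)"
    unfolding m_def by (intro sum_residue assms) (simp only: phase_point1_index[OF assms] 0 if_False)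
  also have "\<dots> = 1" using m by (simp only: phase_point1_index[OF assms] 0 if_True) simp
  finally show ?thesis .
qed

text \<open>The product is a multiple of a Weyl operator, which is traceless unless both exponents
  vanish modulo \<open>p\<close>; since 2 is invertible, that means equal points.\<close>

lemma trace_phase_point1_mult:
  assumes "p > 0" "odd p" "u \<in> point_set p" "v \<in> point_set p"
  shows "trace (phase_point1 p u * phase_point1 p v) = (if u = v then of_nat p else 0)"
proof -
  obtain a b a' b' where uv: "u = (a, b)" "v = (a', b')" by (cases u, cases v)
  have lt: "a < p" "b < p" "a' < p" "b' < p" using assms uv by (auto simp: point_set_def)
  have "int p dvd 2 * (int a - int a') \<and> int p dvd 2 * (int b - int b') \<longleftrightarrow> u = v"
    unfolding odd_dvd_double_iff[OF assms(2)] uv using lt by (auto dest: residue_unique)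
  then show ?thesis
    using assms uv lt
    by (auto simp: phase_point1_mult trace_smult[where n = p] trace_weyl algebra_simps)
qed

text \<open>Completeness of the phase-point operators in the matrix space. A nonzero term needs
  \<open>i + j\<close> and \<open>k + l\<close> both congruent to \<open>2 * b\<close>, the sum over
  \<open>a\<close> forces \<open>i - j\<close> congruent to \<open>k - l\<close>, and oddness of
  \<open>p\<close> separates the indices.\<close>

lemma phase_point1_complete:
  assumes "p > 0" "odd p" "i < p" "j < p" "k < p" "l < p"
  shows "(\<Sum>u\<in>point_set p. phase_point1 p u $$ (i, j) * cnj (phase_point1 p u $$ (k, l))) =
    (if i = k \<and> j = l then of_nat p else 0)"
proof -
  define h where "h = int ((p + 1) div 2)"
  have h: "2 * h = int p + 1" using assms(2) by (auto elim!: oddE simp: h_def)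
  define m where "m = nat ((h * (int i + int j)) mod int p)"
  have m: "m < p" "int p dvd int m - h * (int i + int j)"
    unfolding m_def by (rule residue_properties[OF assms(1)])+
  have 0: "int p dvd int i + int j - 2 * int b \<longleftrightarrow> int p dvd int b - h * (int i + int j)" for b
  proof -
    have "2 * (int b - h * (int i + int j)) = 2 * int b - (2 * h) * (int i + int j)"
      by (simp add: algebra_simps)
    also have "\<dots> = - (int i + int j - 2 * int b) - int p * (int i + int j)"
      unfolding h by (simp add: algebra_simps)
    finally have "2 * (int b - h * (int i + int j)) + int p * (int i + int j) = - (int i + int j - 2 * int b)"
      by simp
    then have "int p dvd - (int i + int j - 2 * int b) \<longleftrightarrow> int p dvd 2 * (int b - h * (int i + int j))"
      by (metis dvd_add_left_iff dvd_triv_left)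
    then show ?thesis using odd_dvd_double_iff[OF assms(2)] by (simp only: dvd_minus_iff)
  qed
  have m2: "int p dvd int i + int j - 2 * int m" using 0 m(2) by simp
  have e: "int p dvd int k + int l - 2 * int m \<and> int p dvd (int i - int j) - (int k - int l) \<longleftrightarrow> i = k \<and> j = l"
  proof safe
    assume d: "int p dvd int k + int l - 2 * int m" "int p dvd (int i - int j) - (int k - int l)"
    have s: "int p dvd (int i + int j) - (int k + int l)"
      using dvd_diff[OF m2 d(1)] by (simp only: diff_diff_eq2 diff_add_cancel)
    have "int p dvd 2 * (int i - int k)" using dvd_add[OF s d(2)] by (simp add: algebra_simps)
    then show "i = k" unfolding odd_dvd_double_iff[OF assms(2)] using residue_unique assms by blast
    have "int p dvd 2 * (int j - int l)" using dvd_diff[OF s d(2)] by (simp add: algebra_simps)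
    then show "j = l" unfolding odd_dvd_double_iff[OF assms(2)] using residue_unique assms by blast
  qed (use m2 in auto)
  have "(\<Sum>u\<in>point_set p. phase_point1 p u $$ (i, j) * cnj (phase_point1 p u $$ (k, l)))
    = (\<Sum>b<p. \<Sum>a<p. phase_point1 p (a, b) $$ (i, j) * cnj (phase_point1 p (a, b) $$ (k, l)))"
    unfolding point_set_def by (subst sum.swap) (simp add: sum.cartesian_product case_prod_unfold)
  also have "\<dots> = (\<Sum>a<p. phase_point1 p (a, m) $$ (i, j) * cnj (phase_point1 p (a, m) $$ (k, l)))"
    unfolding m_def using assms by (intro sum_residue assms) (simp add: phase_point1_index 0)
  also have "\<dots> = (if int p dvd int k + int l - 2 * int m
    then \<Sum>a<p. root_char p (((int i - int j) - (int k - int l)) * int a + 0) else 0)"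
    using assms m2
    by (auto simp: phase_point1_index cnj_root_char simp flip: root_char_add intro!: sum.cong)
      (simp add: algebra_simps)
  also have "\<dots> = (if i = k \<and> j = l then of_nat p else 0)"
    unfolding sum_root_char[OF assms(1)] using e by auto
  finally show ?thesis .
qed

section \<open>The Weyl group of one factor\<close>

text \<open>Arbitrary unit phases and integer exponents make closure under products and adjoints
  immediate; \<open>weyl_operators1_eq\<close> returns to the operators indexed by phase
  space.\<close>

definition weyl_operators1 :: "nat \<Rightarrow> complex mat set" where
  "weyl_operators1 p = {c \<cdot>\<^sub>m weyl p a b | c a b. cmod c = 1}"

lemma weyl_operators1_eq:
  assumes "p > 0"
  shows "weyl_operators1 p = {c \<cdot>\<^sub>m heisenberg_weyl1 p u | c u. cmod c = 1 \<and> u \<in> point_set p}"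
proof (intro equalityI subsetI)
  fix M assume "M \<in> weyl_operators1 p"
  then obtain c a b where M: "M = c \<cdot>\<^sub>m weyl p a b" "cmod c = 1" by (auto simp: weyl_operators1_def)
  define a' b' where "a' = nat (a mod int p)" and "b' = nat (b mod int p)"
  have lt: "a' < p" "b' < p" and d: "int p dvd int a' - a" "int p dvd int b' - b"
    unfolding a'_def b'_def by (rule residue_properties[OF assms])+
  define c' where "c' = cis (- ((real p + 1) * pi * real a' * real b' / real p))"
  have c': "cmod c' = 1" "c' \<noteq> 0" by (auto simp: c'_def)
  have "heisenberg_weyl1 p (a', b') = c' \<cdot>\<^sub>m weyl p a b"
    unfolding heisenberg_weyl1_eq[OF assms] c'_def using weyl_cong[OF assms d] by simp
  then have "M = (c / c') \<cdot>\<^sub>m heisenberg_weyl1 p (a', b')"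
    using M c' by (simp add: smult_smult_mat)
  moreover have "cmod (c / c') = 1" using M c' by (simp add: norm_divide)
  moreover have "(a', b') \<in> point_set p" using lt by (simp add: point_set_def)
  ultimately show "M \<in> {c \<cdot>\<^sub>m heisenberg_weyl1 p u | c u. cmod c = 1 \<and> u \<in> point_set p}" by blast
next
  fix M assume "M \<in> {c \<cdot>\<^sub>m heisenberg_weyl1 p u | c u. cmod c = 1 \<and> u \<in> point_set p}"
  then obtain c a b where "M = c \<cdot>\<^sub>m heisenberg_weyl1 p (a, b)" "cmod c = 1" by auto
  then have "M = (c * cis (- ((real p + 1) * pi * real a * real b / real p))) \<cdot>\<^sub>m weyl p (int a) (int b)"
    "cmod (c * cis (- ((real p + 1) * pi * real a * real b / real p))) = 1"
    by (simp_all only: heisenberg_weyl1_eq[OF assms] smult_smult_mat norm_mult norm_cis mult_1)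
  then show "M \<in> weyl_operators1 p" unfolding weyl_operators1_def by blast
qed

lemma weyl_operators1_carrier: "M \<in> weyl_operators1 p \<Longrightarrow> M \<in> carrier_mat p p"
  by (auto simp: weyl_operators1_def)

lemma smult_mult_smult_mat:
  assumes "A \<in> carrier_mat n n" "B \<in> carrier_mat n n"
  shows "(c \<cdot>\<^sub>m A) * (c' \<cdot>\<^sub>m B) = (c * c' :: complex) \<cdot>\<^sub>m (A * B)"
  using assms by (simp add: mult_smult_assoc_mat[of _ n n _ n] mult_smult_distrib[of _ n n _ n] smult_smult_mat mult.commute)

lemma weyl_operators1_mult:
  assumes "p > 0" "M \<in> weyl_operators1 p" "N \<in> weyl_operators1 p"
  shows "M * N \<in> weyl_operators1 p"
proof -
  obtain c a b c' a' b' where "M = c \<cdot>\<^sub>m weyl p a b" "cmod c = 1" "N = c' \<cdot>\<^sub>m weyl p a' b'" "cmod c' = 1"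
    using assms by (auto simp: weyl_operators1_def)
  then have "M * N = (c * c' * root_char p (- (a' * b))) \<cdot>\<^sub>m weyl p (a + a') (b + b')"
    "cmod (c * c' * root_char p (- (a' * b))) = 1"
    by (simp_all add: smult_mult_smult_mat[of _ p] weyl_mult[OF assms(1)] smult_smult_mat norm_mult)
  then show ?thesis unfolding weyl_operators1_def by blast
qed

lemma weyl_operators1_commute:
  assumes "p > 0" "M \<in> weyl_operators1 p" "N \<in> weyl_operators1 p"
  shows "\<exists>c. M * N = c \<cdot>\<^sub>m (N * M)"
proof -
  obtain c a b c' a' b' where MN: "M = c \<cdot>\<^sub>m weyl p a b" "N = c' \<cdot>\<^sub>m weyl p a' b'"
    using assms by (auto simp: weyl_operators1_def)
  have "M * N = root_char p (a * b' - a' * b) \<cdot>\<^sub>m (N * M)"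
    unfolding MN smult_mult_smult_mat[OF weyl_carrier(1) weyl_carrier(1)] weyl_mult[OF assms(1)] smult_smult_mat
    using root_char_add[of p "a * b' - a' * b" "- (a * b')"]
    by (simp add: add.commute[of a] add.commute[of b] mult_ac)
  then show ?thesis by blast
qed

lemma weyl_operators1_adjoint:
  assumes "p > 0" "M \<in> weyl_operators1 p"
  shows "mat_adjoint M \<in> weyl_operators1 p"
proof -
  obtain c a b where "M = c \<cdot>\<^sub>m weyl p a b" "cmod c = 1"
    using assms by (auto simp: weyl_operators1_def)
  then have "mat_adjoint M = (cnj c * root_char p (- (a * b))) \<cdot>\<^sub>m weyl p (- a) (- b)"
    "cmod (cnj c * root_char p (- (a * b))) = 1"
    by (simp_all add: mat_adjoint_smult weyl_adjoint[OF assms(1)] smult_smult_mat norm_mult)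
  then show ?thesis unfolding weyl_operators1_def by blast
qed

lemma weyl_operators1_unitary:
  assumes "p > 0" "M \<in> weyl_operators1 p"
  shows "M * mat_adjoint M = 1\<^sub>m p"
proof -
  obtain c a b where M: "M = c \<cdot>\<^sub>m weyl p a b" "cmod c = 1"
    using assms by (auto simp: weyl_operators1_def)
  have cc: "c * cnj c = 1" using M(2) by (metis complex_norm_square of_real_1 one_power2)
  have "M * mat_adjoint M = (c * cnj c) \<cdot>\<^sub>m (weyl p a b * mat_adjoint (weyl p a b))"
    unfolding M mat_adjoint_smult by (rule smult_mult_smult_mat) auto
  also have "\<dots> = root_char p (- (a * b)) \<cdot>\<^sub>m (weyl p a b * weyl p (- a) (- b))"
    unfolding cc weyl_adjoint[OF assms(1)] by (simp add: mult_smult_distrib[of _ p p _ p])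
  also have "\<dots> = 1\<^sub>m p"
    by (simp add: weyl_mult[OF assms(1)] smult_smult_mat weyl_zero flip: root_char_add)
  finally show ?thesis .
qed

text \<open>This dichotomy will make distinct elements of a stabilizer orthogonal in the trace inner
  product.\<close>

lemma weyl_operators1_trace:
  assumes "p > 0" "M \<in> weyl_operators1 p"
  shows "trace M = 0 \<or> (\<exists>c. M = c \<cdot>\<^sub>m 1\<^sub>m p)"
proof -
  obtain c a b where M: "M = c \<cdot>\<^sub>m weyl p a b" using assms by (auto simp: weyl_operators1_def)
  show ?thesis
  proof (cases "int p dvd a \<and> int p dvd b")
    case True
    then have "weyl p a b = 1\<^sub>m p" using weyl_cong[OF assms(1), of a 0 b 0] by (simp add: weyl_zero)
    then show ?thesis unfolding M by auto
  next
    case False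
    then have "trace M = 0" unfolding M by (auto simp: trace_smult[of _ p] trace_weyl[OF assms(1)])
    then show ?thesis ..
  qed
qed

lemma phase_point1_mult_weyl:
  assumes "p > 0" "odd p"
  shows "phase_point1 p u * phase_point1 p v \<in> weyl_operators1 p"
  unfolding weyl_operators1_def using phase_point1_mult[OF assms]
  by (cases u, cases v) (auto, metis cmod_root_char)

section \<open>Tensor products of systems\<close>

lemma phase_space_Nil [simp]: "phase_space [] = {[]}"
  by (simp add: phase_space_def)

lemma phase_space_Cons: "phase_space (p # ps) = (\<lambda>(u, us). u # us) ` (point_set p \<times> phase_space ps)"
  by (auto simp: phase_space_def set_Cons_def)

lemma finite_phase_space [simp]: "finite (phase_space ps)"
  by (induction ps) (auto simp: phase_space_Cons point_set_def)

lemma length_phase_space: "us \<in> phase_space ps \<Longrightarrow> length us = length ps"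
  by (induction ps arbitrary: us) (auto simp: phase_space_Cons)

lemma phase_space_append:
  "us \<in> phase_space (ps @ qs) \<Longrightarrow> \<exists>vs\<in>phase_space ps. \<exists>ws\<in>phase_space qs. us = vs @ ws"
proof (induction ps arbitrary: us)
  case (Cons p ps)
  then obtain u vs where "us = u # vs" "u \<in> point_set p" "vs \<in> phase_space (ps @ qs)"
    by (auto simp: phase_space_Cons)
  moreover from this(3) obtain vs1 ws where "vs1 \<in> phase_space ps" "ws \<in> phase_space qs" "vs = vs1 @ ws"
    using Cons.IH by blast
  ultimately have "u # vs1 \<in> phase_space (p # ps)" "ws \<in> phase_space qs" "us = (u # vs1) @ ws"
    by (auto simp: phase_space_Cons)
  then show ?case by blast
qed auto

lemma sum_phase_space_Cons:
  "(\<Sum>us\<in>phase_space (p # ps). f us) = (\<Sum>u\<in>point_set p. \<Sum>us\<in>phase_space ps. f (u # us))"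
proof -
  have "inj_on (\<lambda>(u, us). u # us) (point_set p \<times> phase_space ps)" by (auto simp: inj_on_def)
  then show ?thesis
    by (simp add: phase_space_Cons sum.reindex sum.cartesian_product case_prod_unfold)
qed

lemma phase_point_Nil [simp]: "phase_point [] us = 1\<^sub>m 1"
  by (simp add: phase_point_def tensor_list_def)

lemma phase_point_Cons [simp]:
  "phase_point (p # ps) (u # us) = kron (phase_point1 p u) (phase_point ps us)"
  by (simp add: phase_point_def tensor_list_def)

lemma heisenberg_weyl_Nil [simp]: "heisenberg_weyl [] us = 1\<^sub>m 1"
  by (simp add: heisenberg_weyl_def tensor_list_def)

lemma heisenberg_weyl_Cons [simp]:
  "heisenberg_weyl (p # ps) (u # us) = kron (heisenberg_weyl1 p u) (heisenberg_weyl ps us)"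
  by (simp add: heisenberg_weyl_def tensor_list_def)

lemma phase_point_append:
  assumes "us \<in> phase_space ps"
  shows "phase_point (ps @ qs) (us @ vs) = kron (phase_point ps us) (phase_point qs vs)"
  using length_phase_space[OF assms] by (simp add: phase_point_def tensor_list_append)

lemma phase_point_carrier:
  "us \<in> phase_space ps \<Longrightarrow> phase_point ps us \<in> carrier_mat (prod_list ps) (prod_list ps)"
  by (induction ps arbitrary: us) (auto simp: phase_space_Cons)

lemma heisenberg_weyl_carrier:
  "us \<in> phase_space ps \<Longrightarrow> heisenberg_weyl ps us \<in> carrier_mat (prod_list ps) (prod_list ps)"
  by (induction ps arbitrary: us) (auto simp: phase_space_Cons)

text \<open>Oddness makes 2 invertible modulo each factor and also excludes the factor 0, so every
  dimension is positive.\<close>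

definition odd_dims :: "nat list \<Rightarrow> bool" where
  "odd_dims ps \<longleftrightarrow> (\<forall>p\<in>set ps. odd p)"

lemma odd_dims_Cons [simp]: "odd_dims (p # ps) \<longleftrightarrow> odd p \<and> odd_dims ps"
  by (simp add: odd_dims_def)

lemma odd_dims_copies: "odd_dims ps \<Longrightarrow> odd_dims (concat (replicate n ps))"
  by (auto simp: odd_dims_def)

lemma prod_list_pos: "odd_dims ps \<Longrightarrow> prod_list ps > 0"
  by (induction ps) (auto intro: odd_pos)

section \<open>Phase-point operators of composite systems\<close>

lemma phase_point_adjoint:
  "odd_dims ps \<Longrightarrow> us \<in> phase_space ps \<Longrightarrow> mat_adjoint (phase_point ps us) = phase_point ps us"
  by (induction ps arbitrary: us)
    (auto simp: phase_space_Cons kron_adjoint phase_point1_adjoint odd_pos simp del: One_nat_def)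

lemma phase_point_square:
  "odd_dims ps \<Longrightarrow> us \<in> phase_space ps \<Longrightarrow> phase_point ps us * phase_point ps us = 1\<^sub>m (prod_list ps)"
proof (induction ps arbitrary: us)
  case (Cons p ps)
  then obtain v vs where us: "us = v # vs" "v \<in> point_set p" "vs \<in> phase_space ps"
    by (auto simp: phase_space_Cons)
  have "phase_point (p # ps) us * phase_point (p # ps) us
    = kron (phase_point1 p v * phase_point1 p v) (phase_point ps vs * phase_point ps vs)"
    unfolding us phase_point_Cons
    using us by (intro kron_mult[of _ p p _ p _ "prod_list ps" "prod_list ps" _ "prod_list ps"])
      (auto simp: phase_point_carrier)
  then show ?case using Cons us by (simp add: phase_point1_square odd_pos kron_one)
qed auto

lemma trace_phase_point:
  "odd_dims ps \<Longrightarrow> us \<in> phase_space ps \<Longrightarrow> trace (phase_point ps us) = 1"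
proof (induction ps arbitrary: us)
  case (Cons p ps)
  then obtain v vs where us: "us = v # vs" "v \<in> point_set p" "vs \<in> phase_space ps"
    by (auto simp: phase_space_Cons)
  then show ?case using Cons
    by (simp add: trace_kron[of _ p _ "prod_list ps"] phase_point_carrier trace_phase_point1 odd_pos)
qed (simp add: trace_def)

lemma trace_phase_point_mult:
  "odd_dims ps \<Longrightarrow> us \<in> phase_space ps \<Longrightarrow> vs \<in> phase_space ps \<Longrightarrow>
   trace (phase_point ps us * phase_point ps vs) = (if us = vs then of_nat (prod_list ps) else 0)"
proof (induction ps arbitrary: us vs)
  case (Cons p ps)
  obtain u1 us1 where us: "us = u1 # us1" "u1 \<in> point_set p" "us1 \<in> phase_space ps"
    using Cons.prems by (auto simp: phase_space_Cons)
  obtain v1 vs1 where vs: "vs = v1 # vs1" "v1 \<in> point_set p" "vs1 \<in> phase_space ps"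
    using Cons.prems by (auto simp: phase_space_Cons)
  let ?D = "prod_list ps"
  have "phase_point (p # ps) us * phase_point (p # ps) vs
    = kron (phase_point1 p u1 * phase_point1 p v1) (phase_point ps us1 * phase_point ps vs1)"
    unfolding us vs phase_point_Cons using us vs
    by (intro kron_mult[of _ p p _ p _ ?D ?D _ ?D]) (auto simp: phase_point_carrier)
  also have "trace \<dots> = trace (phase_point1 p u1 * phase_point1 p v1) * trace (phase_point ps us1 * phase_point ps vs1)"
    using us vs by (intro trace_kron[of _ p _ ?D]) (auto intro!: mult_carrier_mat phase_point_carrier)
  finally show ?case using Cons us vs by (simp add: trace_phase_point1_mult odd_pos)
qed (simp add: trace_def)

text \<open>The sum over the phase space factorizes, and a pair of indices agrees exactly when
  quotients and remainders agree.\<close>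

lemma phase_point_complete:
  "odd_dims ps \<Longrightarrow> i < prod_list ps \<Longrightarrow> j < prod_list ps \<Longrightarrow> k < prod_list ps \<Longrightarrow> l < prod_list ps \<Longrightarrow>
   (\<Sum>us\<in>phase_space ps. phase_point ps us $$ (i, j) * cnj (phase_point ps us $$ (k, l))) =
   (if i = k \<and> j = l then of_nat (prod_list ps) else 0)"
proof (induction ps arbitrary: i j k l)
  case (Cons p ps)
  let ?D = "prod_list ps"
  have lt: "i < p * ?D" "j < p * ?D" "k < p * ?D" "l < p * ?D" using Cons.prems by auto
  have "(\<Sum>us\<in>phase_space (p # ps). phase_point (p # ps) us $$ (i, j) * cnj (phase_point (p # ps) us $$ (k, l)))
    = (\<Sum>u\<in>point_set p. \<Sum>us\<in>phase_space ps.
        (phase_point1 p u $$ (i div ?D, j div ?D) * cnj (phase_point1 p u $$ (k div ?D, l div ?D))) *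
        (phase_point ps us $$ (i mod ?D, j mod ?D) * cnj (phase_point ps us $$ (k mod ?D, l mod ?D))))"
    unfolding sum_phase_space_Cons
  proof (intro sum.cong refl)
    fix u us assume "us \<in> phase_space ps"
    then show "phase_point (p # ps) (u # us) $$ (i, j) * cnj (phase_point (p # ps) (u # us) $$ (k, l)) =
      (phase_point1 p u $$ (i div ?D, j div ?D) * cnj (phase_point1 p u $$ (k div ?D, l div ?D))) *
      (phase_point ps us $$ (i mod ?D, j mod ?D) * cnj (phase_point ps us $$ (k mod ?D, l mod ?D)))"
      using lt carrier_matD[OF phase_point_carrier] by simp
  qed
  also have "\<dots> = (\<Sum>u\<in>point_set p. phase_point1 p u $$ (i div ?D, j div ?D) * cnj (phase_point1 p u $$ (k div ?D, l div ?D))) *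
    (\<Sum>us\<in>phase_space ps. phase_point ps us $$ (i mod ?D, j mod ?D) * cnj (phase_point ps us $$ (k mod ?D, l mod ?D)))"
    by (rule sum_product[symmetric])
  also have "\<dots> = (if i div ?D = k div ?D \<and> j div ?D = l div ?D then of_nat p else 0) *
    (if i mod ?D = k mod ?D \<and> j mod ?D = l mod ?D then of_nat ?D else 0)"
    using Cons lt by (simp add: phase_point1_complete odd_pos div_mod_less)
  also have "\<dots> = (if i = k \<and> j = l then of_nat (prod_list (p # ps)) else 0)"
  proof -
    have "a = b \<longleftrightarrow> a div ?D = b div ?D \<and> a mod ?D = b mod ?D" for a b
      by (metis div_mult_mod_eq)
    from this[of i k] this[of j l] show ?thesis by auto
  qed
  finally show ?case .
qed auto

text \<open>The Born rule in phase space: \<open>trace (E * \<sigma>)\<close> is the sum of the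
  Wigner function of the effect times that of the state. The factor \<open>prod_list ps\<close>
  clears the normalization of the latter.\<close>

lemma phase_point_reconstruction:
  assumes ps: "odd_dims ps"
    and E: "E \<in> carrier_mat (prod_list ps) (prod_list ps)"
    and S: "\<sigma> \<in> carrier_mat (prod_list ps) (prod_list ps)"
  shows "of_nat (prod_list ps) * trace (E * \<sigma>) =
    (\<Sum>us\<in>phase_space ps. trace (E * phase_point ps us) * trace (phase_point ps us * \<sigma>))"
proof -
  let ?D = "prod_list ps" and ?A = "phase_point ps"
  have "(\<Sum>us\<in>phase_space ps. trace (E * ?A us) * trace (?A us * \<sigma>)) =
    (\<Sum>us\<in>phase_space ps. \<Sum>i<?D. \<Sum>j<?D. \<Sum>k<?D. \<Sum>l<?D.
      E $$ (i, j) * \<sigma> $$ (l, k) * (?A us $$ (j, i) * cnj (?A us $$ (l, k))))"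
  proof (intro sum.cong refl)
    fix us assume us: "us \<in> phase_space ps"
    \<comment> \<open>Hermiticity supplies the complex conjugate that the completeness relation
      requires.\<close>
    have herm: "?A us $$ (k, l) = cnj (?A us $$ (l, k))" if "k < ?D" "l < ?D" for k l
      using that phase_point_adjoint[OF ps us] mat_adjoint_index[of k "?A us" l]
        carrier_matD[OF phase_point_carrier[OF us]] by simp
    have t: "trace (?A us * \<sigma>) = (\<Sum>k<?D. \<Sum>l<?D. cnj (?A us $$ (l, k)) * \<sigma> $$ (l, k))"
      unfolding trace_mult_sum[OF phase_point_carrier[OF us] S]
      by (intro sum.cong refl) (subst herm, auto)
    have "trace (E * ?A us) * trace (?A us * \<sigma>)
      = (\<Sum>i<?D. \<Sum>j<?D. E $$ (i, j) * ?A us $$ (j, i) * trace (?A us * \<sigma>))"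
      by (simp only: trace_mult_sum[OF E phase_point_carrier[OF us]] sum_distrib_right)
    then show "trace (E * ?A us) * trace (?A us * \<sigma>) = (\<Sum>i<?D. \<Sum>j<?D. \<Sum>k<?D. \<Sum>l<?D.
      E $$ (i, j) * \<sigma> $$ (l, k) * (?A us $$ (j, i) * cnj (?A us $$ (l, k))))"
      unfolding t sum_distrib_left by (simp only: mult_ac)
  qed
  also have "\<dots> = (\<Sum>i<?D. \<Sum>j<?D. \<Sum>k<?D. \<Sum>l<?D. \<Sum>us\<in>phase_space ps.
      E $$ (i, j) * \<sigma> $$ (l, k) * (?A us $$ (j, i) * cnj (?A us $$ (l, k))))"
    by (simp only: sum.swap[where A = "phase_space ps"])
  also have "\<dots> = (\<Sum>i<?D. \<Sum>j<?D. \<Sum>k<?D. \<Sum>l<?D.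
      if j = l \<and> i = k then of_nat ?D * (E $$ (i, j) * \<sigma> $$ (l, k)) else 0)"
    by (intro sum.cong refl)
      (simp only: sum_distrib_left[symmetric] phase_point_complete[OF ps] lessThan_iff, simp)
  also have "\<dots> = (\<Sum>i<?D. \<Sum>j<?D. of_nat ?D * (E $$ (i, j) * \<sigma> $$ (j, i)))"
  proof (intro sum.cong refl)
    fix i j assume ij: "i \<in> {..<?D}" "j \<in> {..<?D}"
    have "(\<Sum>k<?D. \<Sum>l<?D. if j = l \<and> i = k then of_nat ?D * (E $$ (i, j) * \<sigma> $$ (l, k)) else 0)
      = (\<Sum>k<?D. if i = k then \<Sum>l<?D. if j = l then of_nat ?D * (E $$ (i, j) * \<sigma> $$ (l, k)) else 0 else 0)"
      by (intro sum.cong refl) auto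
    also have "\<dots> = of_nat ?D * (E $$ (i, j) * \<sigma> $$ (j, i))" using ij by simp
    finally show "(\<Sum>k<?D. \<Sum>l<?D. if j = l \<and> i = k then of_nat ?D * (E $$ (i, j) * \<sigma> $$ (l, k)) else 0)
      = of_nat ?D * (E $$ (i, j) * \<sigma> $$ (j, i))" .
  qed
  also have "\<dots> = of_nat ?D * trace (E * \<sigma>)"
    unfolding trace_mult_sum[OF E S] by (simp add: sum_distrib_left)
  finally show ?thesis by simp
qed

section \<open>The Weyl group of composite systems\<close>

definition weyl_operators :: "nat list \<Rightarrow> complex mat set" where
  "weyl_operators ps = {c \<cdot>\<^sub>m heisenberg_weyl ps u | c u. cmod c = 1 \<and> u \<in> phase_space ps}"

lemma weyl_operators_carrier: "M \<in> weyl_operators ps \<Longrightarrow> M \<in> carrier_mat (prod_list ps) (prod_list ps)"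
  by (auto simp: weyl_operators_def heisenberg_weyl_carrier)

lemma weyl_operators_Nil: "weyl_operators [] = {c \<cdot>\<^sub>m 1\<^sub>m 1 | c. cmod c = 1}"
  by (auto simp: weyl_operators_def)

text \<open>A phase can be moved between tensor factors, so it is harmless to give each factor its
  own. Group properties then follow from the single-factor case by induction on
  \<open>ps\<close>.\<close>

lemma weyl_operators_Cons:
  assumes "p > 0"
  shows "weyl_operators (p # ps) = {kron M N | M N. M \<in> weyl_operators1 p \<and> N \<in> weyl_operators ps}"
proof (intro equalityI subsetI)
  fix L assume "L \<in> weyl_operators (p # ps)"
  then obtain c u us where L: "L = kron (c \<cdot>\<^sub>m heisenberg_weyl1 p u) (1 \<cdot>\<^sub>m heisenberg_weyl ps us)"
    "cmod c = 1" "u \<in> point_set p" "us \<in> phase_space ps"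
    by (auto simp: weyl_operators_def phase_space_Cons kron_smult_left)
  then have "c \<cdot>\<^sub>m heisenberg_weyl1 p u \<in> weyl_operators1 p"
    unfolding weyl_operators1_eq[OF assms] by blast
  moreover have "1 \<cdot>\<^sub>m heisenberg_weyl ps us \<in> weyl_operators ps"
    unfolding weyl_operators_def using L norm_one by blast
  ultimately show "L \<in> {kron M N | M N. M \<in> weyl_operators1 p \<and> N \<in> weyl_operators ps}"
    using L by blast
next
  fix L assume "L \<in> {kron M N | M N. M \<in> weyl_operators1 p \<and> N \<in> weyl_operators ps}"
  then obtain c u c' us where
    "L = kron (c \<cdot>\<^sub>m heisenberg_weyl1 p u) (c' \<cdot>\<^sub>m heisenberg_weyl ps us)"
    "cmod c = 1" "cmod c' = 1" "u \<in> point_set p" "us \<in> phase_space ps"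
    unfolding weyl_operators1_eq[OF assms] weyl_operators_def by blast
  then have "L = (c * c') \<cdot>\<^sub>m heisenberg_weyl (p # ps) (u # us)" "cmod (c * c') = 1"
    "u # us \<in> phase_space (p # ps)"
    by (auto simp: kron_smult_left kron_smult_right smult_smult_mat norm_mult phase_space_Cons)
  then show "L \<in> weyl_operators (p # ps)" unfolding weyl_operators_def by blast
qed

lemma weyl_operators_ConsE:
  assumes "L \<in> weyl_operators (p # ps)" "odd_dims (p # ps)"
  obtains M N where "L = kron M N" "M \<in> weyl_operators1 p" "N \<in> weyl_operators ps"
    "M \<in> carrier_mat p p" "N \<in> carrier_mat (prod_list ps) (prod_list ps)"
  using assms weyl_operators_Cons[of p ps] weyl_operators1_carrier weyl_operators_carrier
  by (auto simp: odd_pos)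

lemma weyl_operators_mult:
  "odd_dims ps \<Longrightarrow> M \<in> weyl_operators ps \<Longrightarrow> N \<in> weyl_operators ps \<Longrightarrow> M * N \<in> weyl_operators ps"
proof (induction ps arbitrary: M N)
  case Nil
  then obtain c c' where "M = c \<cdot>\<^sub>m 1\<^sub>m 1" "N = c' \<cdot>\<^sub>m 1\<^sub>m 1" "cmod c = 1" "cmod c' = 1"
    by (auto simp: weyl_operators_Nil)
  then have "M * N = (c * c') \<cdot>\<^sub>m 1\<^sub>m 1" "cmod (c * c') = 1"
    by (simp_all add: smult_mult_smult_mat[of _ 1] norm_mult del: One_nat_def)
  then show ?case unfolding weyl_operators_Nil by blast
next
  case (Cons p ps)
  obtain M1 M2 where M: "M = kron M1 M2" "M1 \<in> weyl_operators1 p" "M2 \<in> weyl_operators ps"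
    "M1 \<in> carrier_mat p p" "M2 \<in> carrier_mat (prod_list ps) (prod_list ps)"
    using weyl_operators_ConsE[OF Cons.prems(2,1)] .
  obtain N1 N2 where N: "N = kron N1 N2" "N1 \<in> weyl_operators1 p" "N2 \<in> weyl_operators ps"
    "N1 \<in> carrier_mat p p" "N2 \<in> carrier_mat (prod_list ps) (prod_list ps)"
    using weyl_operators_ConsE[OF Cons.prems(3,1)] .
  have p: "p > 0" using Cons.prems(1) by (simp add: odd_pos)
  have "M * N = kron (M1 * N1) (M2 * N2)" unfolding M N by (rule kron_mult) (use M N in auto)
  moreover have "M1 * N1 \<in> weyl_operators1 p" using weyl_operators1_mult p M N by blast
  moreover have "M2 * N2 \<in> weyl_operators ps" using Cons M N by simp
  ultimately show ?case unfolding weyl_operators_Cons[OF p] by blast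
qed

lemma weyl_operators_commute:
  "odd_dims ps \<Longrightarrow> M \<in> weyl_operators ps \<Longrightarrow> N \<in> weyl_operators ps \<Longrightarrow> \<exists>c. M * N = c \<cdot>\<^sub>m (N * M)"
proof (induction ps arbitrary: M N)
  case Nil
  then obtain c c' where "M = c \<cdot>\<^sub>m 1\<^sub>m 1" "N = c' \<cdot>\<^sub>m 1\<^sub>m 1"
    by (auto simp: weyl_operators_Nil)
  then have "M * N = 1 \<cdot>\<^sub>m (N * M)"
    by (simp add: smult_mult_smult_mat[of _ 1] mult.commute del: One_nat_def)
  then show ?case by blast
next
  case (Cons p ps)
  obtain M1 M2 where M: "M = kron M1 M2" "M1 \<in> weyl_operators1 p" "M2 \<in> weyl_operators ps"
    "M1 \<in> carrier_mat p p" "M2 \<in> carrier_mat (prod_list ps) (prod_list ps)"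
    using weyl_operators_ConsE[OF Cons.prems(2,1)] .
  obtain N1 N2 where N: "N = kron N1 N2" "N1 \<in> weyl_operators1 p" "N2 \<in> weyl_operators ps"
    "N1 \<in> carrier_mat p p" "N2 \<in> carrier_mat (prod_list ps) (prod_list ps)"
    using weyl_operators_ConsE[OF Cons.prems(3,1)] .
  have p: "p > 0" using Cons.prems(1) by (simp add: odd_pos)
  obtain c where c: "M1 * N1 = c \<cdot>\<^sub>m (N1 * M1)" using weyl_operators1_commute p M N by blast
  obtain c' where c': "M2 * N2 = c' \<cdot>\<^sub>m (N2 * M2)" using Cons M N by fastforce
  have "M * N = kron (M1 * N1) (M2 * N2)" unfolding M N by (rule kron_mult) (use M N in auto)
  also have "\<dots> = (c * c') \<cdot>\<^sub>m kron (N1 * M1) (N2 * M2)"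
    unfolding c c' by (simp add: kron_smult_left kron_smult_right smult_smult_mat mult.commute)
  also have "kron (N1 * M1) (N2 * M2) = N * M"
    unfolding M N by (rule kron_mult[symmetric]) (use M N in auto)
  finally show ?case by blast
qed

lemma weyl_operators_adjoint:
  "odd_dims ps \<Longrightarrow> M \<in> weyl_operators ps \<Longrightarrow> mat_adjoint M \<in> weyl_operators ps"
proof (induction ps arbitrary: M)
  case Nil
  then obtain c where "M = c \<cdot>\<^sub>m 1\<^sub>m 1" "cmod c = 1" by (auto simp: weyl_operators_Nil)
  then have "mat_adjoint M = cnj c \<cdot>\<^sub>m 1\<^sub>m 1" "cmod (cnj c) = 1"
    by (simp_all add: mat_adjoint_smult del: One_nat_def)
  then show ?case unfolding weyl_operators_Nil by blast
next
  case (Cons p ps)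
  obtain M1 M2 where M: "M = kron M1 M2" "M1 \<in> weyl_operators1 p" "M2 \<in> weyl_operators ps"
    using weyl_operators_ConsE[OF Cons.prems(2,1)] .
  have p: "p > 0" using Cons.prems(1) by (simp add: odd_pos)
  show ?case unfolding weyl_operators_Cons[OF p] M kron_adjoint
    using weyl_operators1_adjoint[OF p M(2)] Cons M by auto
qed

lemma weyl_operators_unitary:
  "odd_dims ps \<Longrightarrow> M \<in> weyl_operators ps \<Longrightarrow> M * mat_adjoint M = 1\<^sub>m (prod_list ps)"
proof (induction ps arbitrary: M)
  case Nil
  then obtain c where c: "M = c \<cdot>\<^sub>m 1\<^sub>m 1" "cmod c = 1" by (auto simp: weyl_operators_Nil)
  then have "c * cnj c = 1" by (metis complex_norm_square of_real_1 one_power2)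
  then show ?case unfolding c
    by (simp add: mat_adjoint_smult smult_mult_smult_mat[of _ 1] del: One_nat_def)
next
  case (Cons p ps)
  obtain M1 M2 where M: "M = kron M1 M2" "M1 \<in> weyl_operators1 p" "M2 \<in> weyl_operators ps"
    "M1 \<in> carrier_mat p p" "M2 \<in> carrier_mat (prod_list ps) (prod_list ps)"
    using weyl_operators_ConsE[OF Cons.prems(2,1)] .
  have p: "p > 0" using Cons.prems(1) by (simp add: odd_pos)
  have "M * mat_adjoint M = kron (M1 * mat_adjoint M1) (M2 * mat_adjoint M2)"
    unfolding M kron_adjoint by (rule kron_mult) (use M in auto)
  then show ?case using weyl_operators1_unitary[OF p M(2)] Cons M by (simp add: kron_one)
qed

text \<open>The trace is multiplicative, so one traceless factor suffices; otherwise all factors are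
  scalar and so is their product.\<close>

lemma weyl_operators_trace:
  "odd_dims ps \<Longrightarrow> M \<in> weyl_operators ps \<Longrightarrow> trace M = 0 \<or> (\<exists>c. M = c \<cdot>\<^sub>m 1\<^sub>m (prod_list ps))"
proof (induction ps arbitrary: M)
  case Nil
  then show ?case by (auto simp: weyl_operators_Nil)
next
  case (Cons p ps)
  obtain M1 M2 where M: "M = kron M1 M2" "M1 \<in> weyl_operators1 p" "M2 \<in> weyl_operators ps"
    "M1 \<in> carrier_mat p p" "M2 \<in> carrier_mat (prod_list ps) (prod_list ps)"
    using weyl_operators_ConsE[OF Cons.prems(2,1)] .
  have p: "p > 0" using Cons.prems(1) by (simp add: odd_pos)
  have t: "trace M = trace M1 * trace M2" unfolding M using M by (intro trace_kron)
  have "trace M1 = 0 \<or> (\<exists>c. M1 = c \<cdot>\<^sub>m 1\<^sub>m p)" by (rule weyl_operators1_trace[OF p M(2)])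
  moreover have "trace M2 = 0 \<or> (\<exists>c. M2 = c \<cdot>\<^sub>m 1\<^sub>m (prod_list ps))" using Cons M by simp
  moreover have "M = (c * c') \<cdot>\<^sub>m 1\<^sub>m (prod_list (p # ps))"
    if "M1 = c \<cdot>\<^sub>m 1\<^sub>m p" "M2 = c' \<cdot>\<^sub>m 1\<^sub>m (prod_list ps)" for c c'
    unfolding M that by (simp add: kron_smult_left kron_smult_right smult_smult_mat kron_one mult.commute)
  ultimately show ?case using t by (metis mult_zero_left mult_zero_right)
qed

lemma phase_point_mult_weyl:
  "odd_dims ps \<Longrightarrow> us \<in> phase_space ps \<Longrightarrow> vs \<in> phase_space ps \<Longrightarrow>
   phase_point ps us * phase_point ps vs \<in> weyl_operators ps"
proof (induction ps arbitrary: us vs)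
  case Nil
  have "1\<^sub>m 1 = 1 \<cdot>\<^sub>m (1\<^sub>m 1 :: complex mat)" by simp
  then have "(1\<^sub>m 1 :: complex mat) \<in> weyl_operators []" unfolding weyl_operators_Nil using norm_one by blast
  then show ?case by simp
next
  case (Cons p ps)
  obtain u1 us1 where us: "us = u1 # us1" "us1 \<in> phase_space ps"
    using Cons.prems by (auto simp: phase_space_Cons)
  obtain v1 vs1 where vs: "vs = v1 # vs1" "vs1 \<in> phase_space ps"
    using Cons.prems by (auto simp: phase_space_Cons)
  let ?D = "prod_list ps"
  have p: "p > 0" "odd p" using Cons.prems(1) by (auto simp: odd_pos)
  have "phase_point (p # ps) us * phase_point (p # ps) vs
    = kron (phase_point1 p u1 * phase_point1 p v1) (phase_point ps us1 * phase_point ps vs1)"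
    unfolding us vs phase_point_Cons using us vs
    by (intro kron_mult[of _ p p _ p _ ?D ?D _ ?D]) (auto simp: phase_point_carrier)
  moreover have "phase_point1 p u1 * phase_point1 p v1 \<in> weyl_operators1 p"
    by (rule phase_point1_mult_weyl[OF p])
  moreover have "phase_point ps us1 * phase_point ps vs1 \<in> weyl_operators ps" using Cons us vs by simp
  ultimately show ?case unfolding weyl_operators_Cons[OF p(1)] by blast
qed

section \<open>The cone generated by Gram matrices\<close>

text \<open>These are positive semidefinite matrices presented as finite sums of Gram matrices. The
  explicit factors reduce closure under Kronecker products to an induction.\<close>

inductive gram_cone :: "nat \<Rightarrow> complex mat \<Rightarrow> bool" for D where
  zero: "gram_cone D (0\<^sub>m D D)"
| gram: "X \<in> carrier_mat D D \<Longrightarrow> gram_cone D (X * mat_adjoint X)"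
| add: "gram_cone D A \<Longrightarrow> gram_cone D B \<Longrightarrow> gram_cone D (A + B)"

lemma gram_cone_carrier: "gram_cone D A \<Longrightarrow> A \<in> carrier_mat D D"
  by (induction rule: gram_cone.induct) auto

text \<open>Bilinearity and a double induction reduce the claim to two Gram matrices, whose product
  is the Gram matrix of \<open>kron X Y\<close>.\<close>

lemma gram_cone_kron:
  assumes "gram_cone m A" "gram_cone n B"
  shows "gram_cone (m * n) (kron A B)"
  using assms(1)
proof (induction rule: gram_cone.induct)
  case zero
  have "kron (0\<^sub>m m m) B = 0\<^sub>m (m * n) (m * n)"
    using gram_cone_carrier[OF assms(2)] by (auto simp: kron_zero_left)
  then show ?case by (simp add: gram_cone.zero)
next
  case (gram X)
  show ?case using assms(2)
  proof (induction rule: gram_cone.induct)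
    case zero
    show ?case using gram by (auto simp: kron_zero_right intro: gram_cone.zero)
  next
    case (gram Y)
    have "kron (X * mat_adjoint X) (Y * mat_adjoint Y) = kron X Y * mat_adjoint (kron X Y)"
      unfolding kron_adjoint using \<open>X \<in> _\<close> gram by (intro kron_mult[symmetric]) auto
    then show ?case using gram_cone.gram[of "kron X Y" "m * n"] \<open>X \<in> _\<close> gram by simp
  next
    case (add A' B')
    then show ?case
      using kron_add_right[OF gram_cone_carrier gram_cone_carrier, of n A' B'] by (simp add: gram_cone.add)
  qed
next
  case (add A' B')
  then show ?case
    using kron_add_left[OF gram_cone_carrier gram_cone_carrier, of m A' B'] by (simp add: gram_cone.add)
qed

text \<open>The trace is the sum of the quadratic form of \<open>E\<close> over the columns of
  \<open>X\<close>.\<close>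

lemma trace_mult_gram_nonneg:
  assumes E: "positive_semidefinite D E" and X: "X \<in> carrier_mat D D"
  shows "0 \<le> trace (E * (X * mat_adjoint X))"
proof -
  have Ec: "E \<in> carrier_mat D D" using E by (simp add: positive_semidefinite_def)
  have "trace (E * (X * mat_adjoint X)) =
    (\<Sum>i<D. \<Sum>k<D. \<Sum>j<D. E $$ (i, k) * (X $$ (k, j) * cnj (X $$ (i, j))))"
    using X by (subst trace_mult_sum[OF Ec])
      (auto simp: scalar_prod_def atLeast0LessThan sum_distrib_left intro!: sum.cong)
  also have "\<dots> = (\<Sum>j<D. \<Sum>i<D. \<Sum>k<D. E $$ (i, k) * (X $$ (k, j) * cnj (X $$ (i, j))))"
    by (subst (2) sum.swap, subst sum.swap) simp
  also have "\<dots> = (\<Sum>j<D. (E *\<^sub>v col X j) \<bullet>c col X j)"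
    using X Ec by (intro sum.cong refl)
      (auto simp: scalar_prod_def atLeast0LessThan sum_distrib_left mult_ac intro!: sum.cong)
  also have "0 \<le> \<dots>"
    using E X by (intro sum_nonneg) (auto simp: positive_semidefinite_def)
  finally show ?thesis .
qed

lemma trace_mult_gram_cone_nonneg:
  assumes E: "positive_semidefinite D E" and A: "gram_cone D A"
  shows "0 \<le> trace (E * A)"
  using A
proof (induction rule: gram_cone.induct)
  case zero
  have "E * 0\<^sub>m D D = 0\<^sub>m D D"
    using E by (intro right_mult_zero_mat) (auto simp: positive_semidefinite_def)
  then show ?case by (simp add: trace_def)
next
  case (gram X)
  then show ?case using trace_mult_gram_nonneg[OF E] by simp
next
  case (add A B)
  have Ec: "E \<in> carrier_mat D D" using E by (simp add: positive_semidefinite_def)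
  have "trace (E * (A + B)) = trace (E * A) + trace (E * B)"
    using mult_add_distrib_mat[OF Ec, of A D B] add.hyps gram_cone_carrier[of D] Ec
    by (simp add: trace_add[of _ D])
  then show ?case using add by simp
qed

text \<open>On a Gram matrix the scalar is absorbed by scaling \<open>X\<close> with its square
  root.\<close>

lemma gram_cone_smult:
  assumes "gram_cone D A" "0 \<le> (c :: real)"
  shows "gram_cone D (of_real c \<cdot>\<^sub>m A)"
  using assms(1)
proof (induction rule: gram_cone.induct)
  case zero
  then show ?case by (simp add: gram_cone.zero)
next
  case (gram X)
  have "of_real c \<cdot>\<^sub>m (X * mat_adjoint X) =
    (of_real (sqrt c) \<cdot>\<^sub>m X) * mat_adjoint (of_real (sqrt c) \<cdot>\<^sub>m X)"
    using gram assms(2)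
    by (simp add: mat_adjoint_smult smult_mult_smult_mat[of _ D] flip: of_real_mult)
  then show ?case using gram_cone.gram[of "of_real (sqrt c) \<cdot>\<^sub>m X" D] gram by simp
next
  case (add A B)
  have "of_real c \<cdot>\<^sub>m (A + B) = of_real c \<cdot>\<^sub>m A + of_real c \<cdot>\<^sub>m B"
    by (rule add_smult_distrib_left_mat[OF gram_cone_carrier gram_cone_carrier, OF add.hyps])
  then show ?case using add by (simp add: gram_cone.add)
qed

lemma gram_cone_mat_sum:
  assumes "finite S" "\<And>x. x \<in> S \<Longrightarrow> gram_cone D (f x)"
  shows "gram_cone D (mat_sum D f S)"
  using assms
proof (induction rule: finite_induct)
  case empty
  have "mat_sum D f {} = 0\<^sub>m D D" by (intro eq_matI) auto
  then show ?case by (simp add: gram_cone.zero)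
next
  case (insert x S)
  have "mat_sum D f (insert x S) = f x + mat_sum D f S"
    using insert gram_cone_carrier[of D "f x"] by (intro eq_matI) auto
  then show ?case using insert by (simp add: gram_cone.add)
qed

lemma gram_cone_projector:
  assumes "P \<in> carrier_mat D D" "mat_adjoint P = P" "P * P = P"
  shows "gram_cone D P"
  using gram_cone.gram[OF assms(1)] assms by simp

text \<open>The square of \<open>1 - A\<close> is \<open>2 * (1 - A)\<close>, so
  \<open>1 - A\<close> is half a Gram matrix. Applied to phase points, this is the inequality that a
  phase-point operator is at most the identity.\<close>

lemma gram_cone_one_minus_involution:
  assumes A: "A \<in> carrier_mat D D" "mat_adjoint A = A" "A * A = 1\<^sub>m D"
  shows "gram_cone D (1\<^sub>m D - A)"
proof -
  have "(1\<^sub>m D - A) * mat_adjoint (1\<^sub>m D - A) = (1\<^sub>m D - A) * (1\<^sub>m D - A)"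
    using A by (simp add: mat_adjoint_minus[of _ D D])
  also have "\<dots> = (1\<^sub>m D - A) - (A - 1\<^sub>m D)"
  proof -
    have c: "1\<^sub>m D - A \<in> carrier_mat D D" using A by auto
    have "(1\<^sub>m D - A) * (1\<^sub>m D - A) = (1\<^sub>m D - A) * 1\<^sub>m D - (1\<^sub>m D - A) * A"
      by (rule mult_minus_distrib_mat[OF c one_carrier_mat A(1)])
    also have "(1\<^sub>m D - A) * A = 1\<^sub>m D * A - A * A"
      by (rule minus_mult_distrib_mat[OF one_carrier_mat A(1) A(1)])
    finally show ?thesis using A(1) c by (simp add: A(3))
  qed
  also have "\<dots> = 2 \<cdot>\<^sub>m (1\<^sub>m D - A)"
    using A by (intro eq_matI) auto
  finally have eq: "1\<^sub>m D - A = of_real (1 / 2) \<cdot>\<^sub>m ((1\<^sub>m D - A) * mat_adjoint (1\<^sub>m D - A))"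
    by (simp add: smult_smult_mat)
  have "gram_cone D (of_real (1 / 2) \<cdot>\<^sub>m ((1\<^sub>m D - A) * mat_adjoint (1\<^sub>m D - A)))"
    using A by (intro gram_cone_smult gram_cone.gram) auto
  then show ?thesis by (subst eq)
qed

section \<open>The stabilizer of a pure state\<close>

lemma mat_minus_eq_0D:
  fixes A B :: "complex mat"
  assumes "A \<in> carrier_mat m n" "B \<in> carrier_mat m n" "A - B = 0\<^sub>m m n"
  shows "A = B"
proof (intro eq_matI)
  fix i j assume ij: "i < dim_row B" "j < dim_col B"
  have "(A - B) $$ (i, j) = 0" using assms ij by auto
  then show "A $$ (i, j) = B $$ (i, j)" using ij by simp
qed (use assms in auto)

text \<open>A self-adjoint idempotent of trace one is a rank-one projector, so purity is expressed
  by equations that suit trace computations.\<close>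

locale pure_state =
  fixes ps :: "nat list" and D :: nat and \<psi> :: "complex mat"
  assumes odd_dims: "odd_dims ps"
    and D: "D = prod_list ps"
    and psi_psd: "positive_semidefinite D \<psi>"
    and psi_adjoint: "mat_adjoint \<psi> = \<psi>"
    and psi_idem: "\<psi> * \<psi> = \<psi>"
    and psi_trace: "trace \<psi> = 1"
begin

lemma psi_carrier: "\<psi> \<in> carrier_mat D D"
  using psi_psd by (simp add: positive_semidefinite_def)

text \<open>The set S of the overview: the points where the Wigner function of \<psi> reaches its
  upper bound \<open>1 / D\<close>.\<close>

definition unit_points :: "(nat \<times> nat) list set" where
  "unit_points = {u \<in> phase_space ps. trace (phase_point ps u * \<psi>) = 1}"

lemma D_pos: "D > 0"
  using prod_list_pos[OF odd_dims] by (simp add: D)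

lemma A_carrier: "u \<in> phase_space ps \<Longrightarrow> phase_point ps u \<in> carrier_mat D D"
  using phase_point_carrier by (simp add: D)

text \<open>The positive matrix \<open>1 - A\<close> has nonnegative trace against \<psi>. In the
  order on complex numbers this also says that the trace is real.\<close>

lemma trace_phase_point_psi_le_1:
  assumes u: "u \<in> phase_space ps"
  shows "trace (phase_point ps u * \<psi>) \<le> 1"
proof -
  let ?A = "phase_point ps u"
  have cone: "gram_cone D (1\<^sub>m D - ?A)"
    using A_carrier[OF u] phase_point_adjoint[OF odd_dims u] phase_point_square[OF odd_dims u]
    by (intro gram_cone_one_minus_involution) (simp_all add: D)
  have "0 \<le> trace (\<psi> * (1\<^sub>m D - ?A))" by (rule trace_mult_gram_cone_nonneg[OF psi_psd cone])
  also have "\<psi> * (1\<^sub>m D - ?A) = \<psi> - \<psi> * ?A"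
    using psi_carrier A_carrier[OF u] by (simp add: mult_minus_distrib_mat[of _ D D _ D])
  also have "trace \<dots> = 1 - trace (?A * \<psi>)"
    using psi_carrier A_carrier[OF u] trace_mult_commute[OF psi_carrier A_carrier[OF u]]
    by (simp add: trace_minus[of _ D] psi_trace)
  finally show ?thesis by (simp add: less_eq_complex_def)
qed

lemma finite_unit_points [simp]: "finite unit_points"
  by (simp add: unit_points_def)

text \<open>This is an equality case of Cauchy-Schwarz: \<psi> and its image under the involution
  have Frobenius norm 1 and inner product 1, so they coincide.\<close>

lemma phase_point_fixes_psi:
  assumes "u \<in> unit_points"
  shows "phase_point ps u * \<psi> = \<psi>"
proof -
  let ?A = "phase_point ps u"
  have u: "u \<in> phase_space ps" and t: "trace (?A * \<psi>) = 1"
    using assms by (auto simp: unit_points_def)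
  note A = A_carrier[OF u] and P = psi_carrier
  have AP: "?A * \<psi> \<in> carrier_mat D D" and PA: "\<psi> * ?A \<in> carrier_mat D D" using A P by auto
  have adj: "mat_adjoint (?A * \<psi>) = \<psi> * ?A"
    using mat_adjoint_mult[OF A P] phase_point_adjoint[OF odd_dims u] by (simp add: psi_adjoint)
  have sq: "?A * ?A = 1\<^sub>m D" using phase_point_square[OF odd_dims u] by (simp add: D)
  have "\<psi> * (\<psi> * ?A) = \<psi> * ?A"
    using assoc_mult_mat[OF P P A] by (simp add: psi_idem)
  moreover have "(?A * \<psi>) * (\<psi> * ?A) = ?A * (\<psi> * (\<psi> * ?A))"
    by (rule assoc_mult_mat[OF A P PA])
  ultimately have "trace ((?A * \<psi>) * (\<psi> * ?A)) = trace (?A * (\<psi> * ?A))" by simp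
  also have "\<dots> = trace ((\<psi> * ?A) * ?A)" by (rule trace_mult_commute[OF A PA])
  also have "(\<psi> * ?A) * ?A = \<psi>" using assoc_mult_mat[OF P A A] P by (simp add: sq)
  finally have 1: "trace ((?A * \<psi>) * (\<psi> * ?A)) = 1" by (simp add: psi_trace)
  have "trace (\<psi> * (\<psi> * ?A)) = trace (?A * \<psi>)"
    using \<open>\<psi> * (\<psi> * ?A) = _\<close> trace_mult_commute[OF A P] by simp
  moreover have "trace ((?A * \<psi>) * \<psi>) = trace (?A * \<psi>)"
    using assoc_mult_mat[OF A P P] by (simp add: psi_idem)
  ultimately have 2: "trace (\<psi> * (\<psi> * ?A)) = 1" "trace ((?A * \<psi>) * \<psi>) = 1" using t by auto
  \<comment> \<open>The squared norm of this difference expands into four traces, each equal to 1,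
    with signs that cancel.\<close>
  let ?d = "?A * \<psi> - \<psi>"
  have "mat_adjoint ?d = \<psi> * ?A - \<psi>"
    using mat_adjoint_minus[OF AP P] by (simp add: adj psi_adjoint)
  then have "?d * mat_adjoint ?d = ((?A * \<psi>) * (\<psi> * ?A) - (?A * \<psi>) * \<psi>) - (\<psi> * (\<psi> * ?A) - \<psi> * \<psi>)"
    using AP PA P
    by (simp only: minus_mult_distrib_mat[OF AP P minus_carrier_mat] mult_minus_distrib_mat[OF AP PA P] mult_minus_distrib_mat[OF P PA P])
  also have "trace \<dots> = 0"
    using trace_minus[OF minus_carrier_mat[OF mult_carrier_mat[OF AP P]] minus_carrier_mat[OF mult_carrier_mat[OF P P]]]
      trace_minus[OF mult_carrier_mat[OF AP PA] mult_carrier_mat[OF AP P]]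
      trace_minus[OF mult_carrier_mat[OF P PA] mult_carrier_mat[OF P P]] 1 2
    by (simp add: psi_idem psi_trace del: assoc_mult_mat)
  finally have "?d = 0\<^sub>m D D"
    using trace_mult_adjoint_eq_0D[OF minus_carrier_mat[OF P]] by simp
  then show ?thesis by (rule mat_minus_eq_0D[OF AP P])
qed

definition stabilizer :: "complex mat set" where
  "stabilizer = {g \<in> weyl_operators ps. g * \<psi> = \<psi>}"

lemma stabilizer_carrier: "g \<in> stabilizer \<Longrightarrow> g \<in> carrier_mat D D"
  by (auto simp: stabilizer_def weyl_operators_carrier D)

lemma stabilizer_scalar:
  assumes "c \<cdot>\<^sub>m 1\<^sub>m D \<in> stabilizer"
  shows "c = 1"
proof -
  have "c \<cdot>\<^sub>m \<psi> = \<psi>"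
    using assms psi_carrier by (simp add: stabilizer_def mult_smult_assoc_mat[of _ D D _ D])
  then have "c * trace \<psi> = trace \<psi>" by (metis trace_smult[OF psi_carrier])
  then show ?thesis by (simp add: psi_trace)
qed

lemma stabilizer_mult:
  assumes "g \<in> stabilizer" "h \<in> stabilizer"
  shows "g * h \<in> stabilizer"
  using assms weyl_operators_mult[OF odd_dims]
    assoc_mult_mat[OF stabilizer_carrier stabilizer_carrier psi_carrier, of g h]
  by (simp add: stabilizer_def)

text \<open>Weyl operators commute up to a scalar, and since both orders of the product fix \<psi>,
  that scalar is 1.\<close>

lemma stabilizer_commute:
  assumes "g \<in> stabilizer" "h \<in> stabilizer"
  shows "g * h = h * g"
proof -
  obtain c where c: "g * h = c \<cdot>\<^sub>m (h * g)"
    using weyl_operators_commute[OF odd_dims] assms by (auto simp: stabilizer_def)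
  have "\<psi> = g * h * \<psi>" using stabilizer_mult[OF assms] by (simp add: stabilizer_def)
  also have "\<dots> = c \<cdot>\<^sub>m (h * g * \<psi>)"
    unfolding c
    by (rule mult_smult_assoc_mat[OF mult_carrier_mat[OF stabilizer_carrier stabilizer_carrier] psi_carrier, OF assms(2,1)])
  also have "h * g * \<psi> = \<psi>" using stabilizer_mult[OF assms(2,1)] by (simp add: stabilizer_def)
  finally have "trace \<psi> = c * trace \<psi>" by (metis trace_smult[OF psi_carrier])
  then have "c = 1" by (simp add: psi_trace)
  then show ?thesis using c by simp
qed

lemma stabilizer_unitary:
  assumes "g \<in> stabilizer"
  shows "g * mat_adjoint g = 1\<^sub>m D" "mat_adjoint g * g = 1\<^sub>m D"
proof -
  show "g * mat_adjoint g = 1\<^sub>m D"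
    using weyl_operators_unitary[OF odd_dims] assms by (simp add: stabilizer_def D)
  then show "mat_adjoint g * g = 1\<^sub>m D"
    using mat_mult_left_right_inverse[of g D "mat_adjoint g"] stabilizer_carrier[OF assms] by simp
qed

lemma stabilizer_adjoint:
  assumes "g \<in> stabilizer"
  shows "mat_adjoint g \<in> stabilizer"
proof -
  have g: "g \<in> carrier_mat D D" by (rule stabilizer_carrier[OF assms])
  have "mat_adjoint g * \<psi> = mat_adjoint g * (g * \<psi>)"
    using assms by (simp add: stabilizer_def)
  also have "\<dots> = (mat_adjoint g * g) * \<psi>"
    using g psi_carrier by (intro assoc_mult_mat[symmetric]) auto
  also have "\<dots> = \<psi>" using stabilizer_unitary[OF assms] psi_carrier by simp
  finally show ?thesis
    using weyl_operators_adjoint[OF odd_dims] assms by (simp add: stabilizer_def)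
qed

text \<open>The identity is the square of any phase-point operator and hence a Weyl operator.
  Completeness ensures that a phase-space point exists.\<close>

lemma stabilizer_one: "1\<^sub>m D \<in> stabilizer"
proof -
  have "phase_space ps \<noteq> {}"
  proof
    assume "phase_space ps = {}"
    then have "of_nat D = (0 :: complex)"
      using phase_point_complete[OF odd_dims, of 0 0 0 0] D_pos by (simp add: D)
    then show False using D_pos by simp
  qed
  then obtain u where u: "u \<in> phase_space ps" by blast
  have "1\<^sub>m D \<in> weyl_operators ps"
    using phase_point_mult_weyl[OF odd_dims u u] phase_point_square[OF odd_dims u] by (simp add: D)
  then show ?thesis using psi_carrier by (simp add: stabilizer_def)
qed

text \<open>Taking the trace against \<psi> determines the phase of an element from its phase-space
  point, and there are finitely many points.\<close>

lemma finite_stabilizer [simp]: "finite stabilizer"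
proof (rule finite_subset)
  show "stabilizer \<subseteq> (\<lambda>u. (1 / trace (heisenberg_weyl ps u * \<psi>)) \<cdot>\<^sub>m heisenberg_weyl ps u) ` phase_space ps"
  proof
    fix g assume g: "g \<in> stabilizer"
    then obtain c u where u: "g = c \<cdot>\<^sub>m heisenberg_weyl ps u" "u \<in> phase_space ps"
      by (auto simp: stabilizer_def weyl_operators_def)
    have T: "heisenberg_weyl ps u \<in> carrier_mat D D" using heisenberg_weyl_carrier[OF u(2)] by (simp add: D)
    have "trace (g * \<psi>) = 1" using g by (simp add: stabilizer_def psi_trace)
    moreover have "g * \<psi> = c \<cdot>\<^sub>m (heisenberg_weyl ps u * \<psi>)"
      unfolding u by (rule mult_smult_assoc_mat[OF T psi_carrier])
    ultimately have "c * trace (heisenberg_weyl ps u * \<psi>) = 1"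
      using trace_smult[OF mult_carrier_mat[OF T psi_carrier]] by simp
    then have "c = 1 / trace (heisenberg_weyl ps u * \<psi>)"
      by (metis nonzero_eq_divide_eq mult_zero_right zero_neq_one)
    then show "g \<in> (\<lambda>u. (1 / trace (heisenberg_weyl ps u * \<psi>)) \<cdot>\<^sub>m heisenberg_weyl ps u) ` phase_space ps"
      using u by auto
  qed
qed simp

text \<open>Fix one unit point \<open>v\<close> and multiply the phase-point operators of all unit
  points by that of \<open>v\<close>. The results are Weyl operators fixing \<psi>, and
  multiplication by an involution is injective.\<close>

lemma card_unit_points_le: "card unit_points \<le> card stabilizer"
proof (cases "unit_points = {}")
  case False
  then obtain v where v: "v \<in> unit_points" by auto
  then have vp: "v \<in> phase_space ps" by (simp add: unit_points_def)
  let ?f = "\<lambda>u. phase_point ps u * phase_point ps v"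
  have "inj_on ?f unit_points"
  proof (rule inj_onI)
    fix u w assume u: "u \<in> unit_points" and w: "w \<in> unit_points" and eq: "?f u = ?f w"
    have up: "u \<in> phase_space ps" and wp: "w \<in> phase_space ps" using u w by (auto simp: unit_points_def)
    have "phase_point ps x = ?f x * phase_point ps v" if "x \<in> phase_space ps" for x
      using assoc_mult_mat[OF A_carrier[OF that] A_carrier[OF vp] A_carrier[OF vp]]
        phase_point_square[OF odd_dims vp] A_carrier[OF that] by (simp add: D)
    then have "phase_point ps u = phase_point ps w" using eq up wp by metis
    then have "trace (phase_point ps u * phase_point ps w) = of_nat D"
      using trace_phase_point_mult[OF odd_dims up up] by (simp add: D)
    moreover have "trace (phase_point ps u * phase_point ps w) = (if u = w then of_nat D else 0)"
      using trace_phase_point_mult[OF odd_dims up wp] by (simp add: D)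
    ultimately show "u = w" using D_pos by (auto split: if_splits)
  qed
  moreover have "?f ` unit_points \<subseteq> stabilizer"
  proof
    fix g assume "g \<in> ?f ` unit_points"
    then obtain u where u: "u \<in> unit_points" "g = ?f u" by auto
    then have up: "u \<in> phase_space ps" by (simp add: unit_points_def)
    have "g * \<psi> = \<psi>"
      using assoc_mult_mat[OF A_carrier[OF up] A_carrier[OF vp] psi_carrier]
        phase_point_fixes_psi u v by simp
    then show "g \<in> stabilizer"
      using phase_point_mult_weyl[OF odd_dims up vp] u by (simp add: stabilizer_def)
  qed
  ultimately show ?thesis by (rule card_inj_on_le) simp
qed simp

text \<open>The product of \<open>g\<close> with the adjoint of \<open>h\<close> lies in the
  stabilizer. It is traceless unless scalar, and the only scalar there is the identity, which would
  give \<open>g = h\<close>.\<close>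

lemma stabilizer_orthogonal:
  assumes g: "g \<in> stabilizer" and h: "h \<in> stabilizer"
  shows "trace (g * mat_adjoint h) = (if g = h then of_nat D else 0)"
proof (cases "g = h")
  case True
  then show ?thesis using stabilizer_unitary[OF h] by simp
next
  case False
  let ?k = "g * mat_adjoint h"
  have k: "?k \<in> stabilizer" using stabilizer_mult[OF g stabilizer_adjoint[OF h]] .
  have "?k \<noteq> c \<cdot>\<^sub>m 1\<^sub>m D" for c
  proof
    assume "?k = c \<cdot>\<^sub>m 1\<^sub>m D"
    moreover from this have "c = 1" using stabilizer_scalar k by simp
    ultimately have "?k = 1\<^sub>m D" by simp
    moreover have "?k * h = g"
      using assoc_mult_mat[of g D D "mat_adjoint h" D h D] stabilizer_carrier[OF g] stabilizer_carrier[OF h]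
        stabilizer_unitary[OF h] by simp
    ultimately have "g = h" using stabilizer_carrier[OF h] by simp
    then show False using False by simp
  qed
  then show ?thesis
    using weyl_operators_trace[OF odd_dims, of ?k] k False by (auto simp: stabilizer_def D)
qed

lemma stabilizer_group_stabilizer: "stabilizer_group ps stabilizer"
proof -
  have grp: "comm_group \<lparr>carrier = stabilizer, monoid.mult = (*), one = 1\<^sub>m D\<rparr>"
  proof (rule comm_groupI, simp_all)
    fix x y z assume "x \<in> stabilizer" "y \<in> stabilizer" "z \<in> stabilizer"
    then show "x * y * z = x * (y * z)"
      using assoc_mult_mat[OF stabilizer_carrier stabilizer_carrier stabilizer_carrier] by simp
  next
    fix x assume "x \<in> stabilizer"
    then show "\<exists>y\<in>stabilizer. y * x = 1\<^sub>m D" using stabilizer_adjoint stabilizer_unitary by blast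
  qed (auto simp: stabilizer_mult stabilizer_one stabilizer_commute
      intro: left_mult_one_mat right_mult_one_mat stabilizer_carrier)
  have "\<exists>c u. cmod c = 1 \<and> u \<in> phase_space ps \<and> g = c \<cdot>\<^sub>m heisenberg_weyl ps u" if "g \<in> stabilizer" for g
    using that by (auto simp: stabilizer_def weyl_operators_def)
  then show ?thesis
    using grp stabilizer_unitary stabilizer_scalar by (simp add: stabilizer_group_def D)
qed

text \<open>With \<Sigma> the sum of the stabilizer and N its order, the squared Frobenius norm of
  \<Sigma> minus N times \<psi> is \<open>N * D - N * N\<close>. It cannot be positive once N is at
  least \<open>D\<close>.\<close>

lemma psi_eq_stabilizer_average:
  assumes "D \<le> card unit_points"
  shows "\<psi> = (1 / of_nat (card stabilizer)) \<cdot>\<^sub>m mat_sum D (\<lambda>g. g) stabilizer"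
proof -
  let ?G = stabilizer
  define N where "N = card stabilizer"
  define \<Sigma> where "\<Sigma> = mat_sum D (\<lambda>g. g) ?G"
  have N: "D \<le> N" "N > 0" using assms card_unit_points_le D_pos by (auto simp: N_def)
  have S: "\<Sigma> \<in> carrier_mat D D" by (simp add: \<Sigma>_def)
  have carr: "\<And>g. g \<in> ?G \<Longrightarrow> g \<in> carrier_mat D D" by (rule stabilizer_carrier)
  have "\<Sigma> * \<psi> = mat_sum D (\<lambda>g. g * \<psi>) ?G"
    unfolding \<Sigma>_def by (rule mat_sum_mult_right[OF carr psi_carrier])
  also have "\<dots> = of_nat N \<cdot>\<^sub>m \<psi>"
    using psi_carrier by (intro eq_matI) (auto simp: stabilizer_def N_def)
  finally have Sp: "\<Sigma> * \<psi> = of_nat N \<cdot>\<^sub>m \<psi>" .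
  have adj_sum: "mat_adjoint \<Sigma> = mat_sum D mat_adjoint ?G"
    unfolding \<Sigma>_def by (rule mat_adjoint_mat_sum) (rule carr)
  have adjS: "mat_adjoint \<Sigma> \<in> carrier_mat D D" using S by simp
  have "mat_adjoint (\<Sigma> * \<psi>) = mat_adjoint (of_nat N \<cdot>\<^sub>m \<psi>)" by (simp only: Sp)
  then have pS: "\<psi> * mat_adjoint \<Sigma> = of_nat N \<cdot>\<^sub>m \<psi>"
    using mat_adjoint_mult[OF S psi_carrier] by (simp add: psi_adjoint mat_adjoint_smult)
  have "trace (\<Sigma> * mat_adjoint \<Sigma>) = (\<Sum>g\<in>?G. trace (g * mat_adjoint \<Sigma>))"
  proof -
    have "\<Sigma> * mat_adjoint \<Sigma> = mat_sum D (\<lambda>g. g * mat_adjoint \<Sigma>) ?G"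
      unfolding \<Sigma>_def by (rule mat_sum_mult_right[OF carr adjS[unfolded \<Sigma>_def]])
    then show ?thesis using trace_mat_sum[OF mult_carrier_mat[OF carr adjS]] by simp
  qed
  also have "\<dots> = (\<Sum>g\<in>?G. \<Sum>h\<in>?G. trace (g * mat_adjoint h))"
  proof (intro sum.cong refl)
    fix g assume g: "g \<in> ?G"
    have "trace (g * mat_adjoint \<Sigma>) = trace (mat_adjoint \<Sigma> * g)"
      by (rule trace_mult_commute[OF carr[OF g] adjS])
    also have "mat_adjoint \<Sigma> * g = mat_sum D (\<lambda>h. mat_adjoint h * g) ?G"
      unfolding adj_sum by (rule mat_sum_mult_right) (simp_all add: carr g)
    also have "trace \<dots> = (\<Sum>h\<in>?G. trace (mat_adjoint h * g))"
      by (rule trace_mat_sum) (simp add: mult_carrier_mat[of _ D D] carr g)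
    also have "\<dots> = (\<Sum>h\<in>?G. trace (g * mat_adjoint h))"
      by (intro sum.cong refl trace_mult_commute[of _ D D]) (simp_all add: carr g)
    finally show "trace (g * mat_adjoint \<Sigma>) = (\<Sum>h\<in>?G. trace (g * mat_adjoint h))" .
  qed
  also have "\<dots> = of_nat N * of_nat D"
    by (simp add: stabilizer_orthogonal N_def)
  finally have SS: "trace (\<Sigma> * mat_adjoint \<Sigma>) = of_nat N * of_nat D" .
  let ?d = "\<Sigma> - of_nat N \<cdot>\<^sub>m \<psi>"
  have Np: "of_nat N \<cdot>\<^sub>m \<psi> \<in> carrier_mat D D" using psi_carrier by simp
  have "mat_adjoint ?d = mat_adjoint \<Sigma> - of_nat N \<cdot>\<^sub>m \<psi>"
    using mat_adjoint_minus[OF S Np] by (simp add: mat_adjoint_smult psi_adjoint)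
  then have "?d * mat_adjoint ?d = (\<Sigma> * mat_adjoint \<Sigma> - \<Sigma> * (of_nat N \<cdot>\<^sub>m \<psi>))
    - ((of_nat N \<cdot>\<^sub>m \<psi>) * mat_adjoint \<Sigma> - (of_nat N \<cdot>\<^sub>m \<psi>) * (of_nat N \<cdot>\<^sub>m \<psi>))"
    using minus_mult_distrib_mat[OF S Np minus_carrier_mat[OF Np]]
      mult_minus_distrib_mat[OF S adjS Np] mult_minus_distrib_mat[OF Np adjS Np] by simp
  also have "\<dots> = (\<Sigma> * mat_adjoint \<Sigma> - (of_nat N * of_nat N) \<cdot>\<^sub>m \<psi>)
    - ((of_nat N * of_nat N) \<cdot>\<^sub>m \<psi> - (of_nat N * of_nat N) \<cdot>\<^sub>m \<psi>)"
    using mult_smult_distrib[OF S psi_carrier, of "of_nat N"] mult_smult_assoc_mat[OF psi_carrier adjS, of "of_nat N"]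
      smult_mult_smult_mat[OF psi_carrier psi_carrier, of "of_nat N" "of_nat N"]
    by (simp add: Sp pS psi_idem smult_smult_mat)
  also have "trace \<dots> = of_nat N * of_nat D - of_nat N * of_nat N"
  proof -
    have K: "(of_nat N * of_nat N) \<cdot>\<^sub>m \<psi> \<in> carrier_mat D D" using psi_carrier by simp
    show ?thesis
      by (simp only: trace_minus[OF minus_carrier_mat[OF K] minus_carrier_mat[OF K]]
        trace_minus[OF mult_carrier_mat[OF S adjS] K] trace_minus[OF K K]
        trace_smult[OF psi_carrier] SS psi_trace) simp
  qed
  \<comment> \<open>Here the assumption on the number of unit points enters, through
    \<open>D \<le> N\<close>.\<close>
  also have "\<dots> \<le> 0" using N by (simp add: less_eq_complex_def flip: of_nat_mult)
  finally have "?d = 0\<^sub>m D D" by (intro trace_mult_adjoint_eq_0D[OF minus_carrier_mat[OF Np]])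
  then have "\<Sigma> = of_nat N \<cdot>\<^sub>m \<psi>" by (rule mat_minus_eq_0D[OF S Np])
  then show ?thesis unfolding \<Sigma>_def[symmetric] N_def[symmetric] using N by (simp add: smult_smult_mat)
qed

text \<open>Otherwise \<psi> is the average of its stabilizer, a pure stabilizer state, and lies in
  the convex hull with the single weight 1.\<close>

lemma magic_card_unit_points:
  assumes "pure_magic_state ps \<psi>"
  shows "card unit_points < D"
proof (rule ccontr)
  assume "\<not> card unit_points < D"
  then have "pure_stabilizer_state ps \<psi>"
    using assms psi_eq_stabilizer_average stabilizer_group_stabilizer
    unfolding pure_stabilizer_state_def pure_magic_state_def by (auto simp flip: D)
  then have "\<psi> \<in> mat_convex_hull D {P. pure_stabilizer_state ps P}"
    unfolding mat_convex_hull_def using psi_carrier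
    by (auto intro!: exI[of _ "{\<psi>}"] exI[of _ "\<lambda>_. 1"] eq_matI)
  then show False using assms by (simp add: pure_magic_state_def magic_state_def D)
qed

end

section \<open>Domination by an operator without Wigner mass on the unit points\<close>

locale small_state = pure_state +
  assumes card_less: "card unit_points < D"
begin

text \<open>The coefficient is chosen so that the trace against every phase-point operator of a unit
  point is -1, cancelling the contribution of \<psi>. It is positive by \<open>card_less\<close>.
  Without unit points the sum is zero.\<close>

definition excess :: "complex mat" where
  "excess = of_real (1 / (real D - real (card unit_points))) \<cdot>\<^sub>m
     mat_sum D (\<lambda>u. 1\<^sub>m D - phase_point ps u) unit_points"

definition witness :: "complex mat" where
  "witness = \<psi> + excess"

lemma excess_cone: "gram_cone D excess"
  unfolding excess_def
proof (intro gram_cone_smult gram_cone_mat_sum)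
  fix u assume "u \<in> unit_points"
  then have u: "u \<in> phase_space ps" by (simp add: unit_points_def)
  then show "gram_cone D (1\<^sub>m D - phase_point ps u)"
    using A_carrier[OF u] phase_point_adjoint[OF odd_dims u] phase_point_square[OF odd_dims u]
    by (intro gram_cone_one_minus_involution) (simp_all add: D)
qed (use card_less in auto)

lemma excess_carrier: "excess \<in> carrier_mat D D"
  by (rule gram_cone_carrier[OF excess_cone])

lemma psi_cone: "gram_cone D \<psi>"
  by (rule gram_cone_projector[OF psi_carrier psi_adjoint psi_idem])

lemma witness_cone: "gram_cone D witness"
  unfolding witness_def by (rule gram_cone.add[OF psi_cone excess_cone])

lemma witness_carrier: "witness \<in> carrier_mat D D"
  by (rule gram_cone_carrier[OF witness_cone])

text \<open>Each summand of \<open>excess\<close> has trace 1 against the operator at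
  \<open>v\<close>, except the one at \<open>v\<close> itself, which has \<open>1 - D\<close>. Their
  sum \<open>card unit_points - D\<close> is normalized to -1.\<close>

lemma trace_phase_point_witness:
  assumes v: "v \<in> unit_points"
  shows "trace (phase_point ps v * witness) = 0"
proof -
  let ?A = "phase_point ps" and ?S = unit_points
  let ?M = "mat_sum D (\<lambda>u. 1\<^sub>m D - ?A u) ?S"
  have ph: "u \<in> phase_space ps" if "u \<in> ?S" for u using that by (simp add: unit_points_def)
  note Av = A_carrier[OF ph[OF v]]
  have cu: "1\<^sub>m D - ?A u \<in> carrier_mat D D" if "u \<in> ?S" for u
    by (rule minus_carrier_mat[OF A_carrier[OF ph[OF that]]])
  have "trace (?A v * ?M) = trace (?M * ?A v)" by (rule trace_mult_commute[OF Av]) simp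
  also have "?M * ?A v = mat_sum D (\<lambda>u. (1\<^sub>m D - ?A u) * ?A v) ?S"
    by (rule mat_sum_mult_right[OF cu Av])
  also have "trace \<dots> = (\<Sum>u\<in>?S. trace ((1\<^sub>m D - ?A u) * ?A v))"
    by (rule trace_mat_sum[OF mult_carrier_mat[OF cu Av]])
  also have "\<dots> = (\<Sum>u\<in>?S. 1 - (if u = v then of_nat D else 0))"
  proof (intro sum.cong refl)
    fix u assume "u \<in> ?S"
    then have u: "u \<in> phase_space ps" by (rule ph)
    have "(1\<^sub>m D - ?A u) * ?A v = 1\<^sub>m D * ?A v - ?A u * ?A v"
      by (rule minus_mult_distrib_mat[OF one_carrier_mat A_carrier[OF u] Av])
    then have "trace ((1\<^sub>m D - ?A u) * ?A v) = trace (?A v) - trace (?A u * ?A v)"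
      using Av trace_minus[OF Av mult_carrier_mat[OF A_carrier[OF u] Av]] by simp
    then show "trace ((1\<^sub>m D - ?A u) * ?A v) = 1 - (if u = v then of_nat D else 0)"
      using trace_phase_point[OF odd_dims ph[OF v]] trace_phase_point_mult[OF odd_dims u ph[OF v]]
      by (simp add: D)
  qed
  also have "\<dots> = of_nat (card ?S) - of_nat D"
    using v by (simp add: sum_subtractf)
  finally have t: "trace (?A v * ?M) = of_nat (card ?S) - of_nat D" .
  have "trace (?A v * excess) = of_real (1 / (real D - real (card ?S))) * trace (?A v * ?M)"
    unfolding excess_def
    by (simp only: mult_smult_distrib[OF Av mat_sum_carrier(1)]
      trace_smult[OF mult_carrier_mat[OF Av mat_sum_carrier(1)]])
  also have "\<dots> = of_real ((real (card ?S) - real D) / (real D - real (card ?S)))"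
    unfolding t by simp
  also have "(real (card ?S) - real D) / (real D - real (card ?S)) = -1"
    using card_less by (simp add: field_simps)
  finally have "trace (?A v * excess) = -1" by simp
  moreover have "?A v * witness = ?A v * \<psi> + ?A v * excess"
    unfolding witness_def by (rule mult_add_distrib_mat[OF Av psi_carrier excess_carrier])
  moreover have "trace (?A v * \<psi>) = 1" using v by (simp add: unit_points_def)
  ultimately show ?thesis
    using trace_add[OF mult_carrier_mat[OF Av psi_carrier] mult_carrier_mat[OF Av excess_carrier]] by simp
qed

end

section \<open>Tensor powers, positivity and supports of Wigner functions\<close>

lemma tensor_power_0 [simp]: "tensor_power 0 A = 1\<^sub>m 1"
  by (simp add: tensor_power_def tensor_list_def)

lemma tensor_power_Suc [simp]: "tensor_power (Suc n) A = kron A (tensor_power n A)"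
  by (simp add: tensor_power_def tensor_list_def)

lemma tensor_power_carrier: "A \<in> carrier_mat D D \<Longrightarrow> tensor_power n A \<in> carrier_mat (D ^ n) (D ^ n)"
  by (induction n) (auto simp del: One_nat_def)

lemma gram_cone_tensor_power: "gram_cone D A \<Longrightarrow> gram_cone (D ^ n) (tensor_power n A)"
proof (induction n)
  case 0
  have "gram_cone 1 (1\<^sub>m 1)" by (rule gram_cone_projector) auto
  then show ?case by simp
qed (simp add: gram_cone_kron)

text \<open>Tensor powers are monotone on the cone. Expanding one factor at a time, every term other
  than the power of \<open>A\<close> is a Kronecker product of cone elements and is collected in
  \<open>Q\<close>.\<close>

lemma tensor_power_add_cone:
  assumes A: "gram_cone D A" and R: "gram_cone D R"
  shows "\<exists>Q. gram_cone (D ^ n) Q \<and> tensor_power n (A + R) = tensor_power n A + Q"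
proof (induction n)
  case 0
  have "tensor_power 0 (A + R) = tensor_power 0 A + 0\<^sub>m 1 1" by (simp del: One_nat_def)
  then show ?case using gram_cone.zero[of 1] by (metis power_0)
next
  case (Suc n)
  then obtain Q where Q: "gram_cone (D ^ n) Q" "tensor_power n (A + R) = tensor_power n A + Q" by blast
  note Ac = gram_cone_carrier[OF A] and Rc = gram_cone_carrier[OF R]
  note An = gram_cone_tensor_power[OF A, of n]
  have "tensor_power (Suc n) (A + R) = kron A (tensor_power n (A + R)) + kron R (tensor_power n (A + R))"
    by (simp add: kron_add_left[OF Ac Rc])
  also have "kron A (tensor_power n (A + R)) = kron A (tensor_power n A) + kron A Q"
    unfolding Q(2) by (rule kron_add_right[OF gram_cone_carrier[OF An] gram_cone_carrier[OF Q(1)]])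
  also have "kron A (tensor_power n A) + kron A Q + kron R (tensor_power n (A + R))
    = tensor_power (Suc n) A + (kron A Q + kron R (tensor_power n (A + R)))"
    using kron_carrier[OF Ac gram_cone_carrier[OF An]] kron_carrier[OF Ac gram_cone_carrier[OF Q(1)]]
      kron_carrier[OF Rc gram_cone_carrier[OF gram_cone_tensor_power[OF gram_cone.add[OF A R], of n]]]
    by (simp add: assoc_add_mat)
  finally have "tensor_power (Suc n) (A + R)
    = tensor_power (Suc n) A + (kron A Q + kron R (tensor_power n (A + R)))" .
  moreover have "gram_cone (D ^ Suc n) (kron A Q + kron R (tensor_power n (A + R)))"
    using gram_cone.add[OF gram_cone_kron[OF A Q(1)]
      gram_cone_kron[OF R gram_cone_tensor_power[OF gram_cone.add[OF A R], of n]]] by simp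
  ultimately show ?case by blast
qed

lemma prod_list_copies: "prod_list (concat (replicate n ps)) = prod_list ps ^ n"
  by (induction n) auto

lemma trace_phase_point_tensor_power_Suc:
  assumes M: "M \<in> carrier_mat (prod_list ps) (prod_list ps)"
    and v: "v \<in> phase_space ps" and w: "w \<in> phase_space (concat (replicate n ps))"
  shows "trace (phase_point (concat (replicate (Suc n) ps)) (v @ w) * tensor_power (Suc n) M) =
    trace (phase_point ps v * M) * trace (phase_point (concat (replicate n ps)) w * tensor_power n M)"
proof -
  let ?W = "phase_point (concat (replicate n ps)) w" and ?D = "prod_list ps"
  have W: "?W \<in> carrier_mat (?D ^ n) (?D ^ n)" using phase_point_carrier[OF w] by (simp add: prod_list_copies)
  note V = phase_point_carrier[OF v] and Mn = tensor_power_carrier[OF M, of n]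
  have "phase_point (concat (replicate (Suc n) ps)) (v @ w) * tensor_power (Suc n) M
    = kron (phase_point ps v * M) (?W * tensor_power n M)"
    using phase_point_append[OF v] kron_mult[OF V M W Mn] by simp
  then show ?thesis
    using trace_kron[OF mult_carrier_mat[OF V M] mult_carrier_mat[OF W Mn]] by simp
qed

text \<open>Traces over copies factorize. A vanishing product for \<open>M\<close> has a vanishing
  factor, and the corresponding factor for \<open>N\<close> vanishes too; for zero copies the trace
  is 1 and the implication is vacuous.\<close>

lemma trace_phase_point_tensor_power:
  assumes M: "M \<in> carrier_mat (prod_list ps) (prod_list ps)"
    and N: "N \<in> carrier_mat (prod_list ps) (prod_list ps)"
    and nonneg: "\<And>v. v \<in> phase_space ps \<Longrightarrow> 0 \<le> trace (phase_point ps v * M)"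
    and zero: "\<And>v. v \<in> phase_space ps \<Longrightarrow> trace (phase_point ps v * M) = 0 \<Longrightarrow> trace (phase_point ps v * N) = 0"
  shows "u \<in> phase_space (concat (replicate n ps)) \<Longrightarrow>
    0 \<le> trace (phase_point (concat (replicate n ps)) u * tensor_power n M) \<and>
    (trace (phase_point (concat (replicate n ps)) u * tensor_power n M) = 0 \<longrightarrow>
     trace (phase_point (concat (replicate n ps)) u * tensor_power n N) = 0)"
proof (induction n arbitrary: u)
  case 0
  then show ?case by (simp add: less_eq_complex_def del: One_nat_def)
next
  case (Suc n)
  then obtain v w where vw: "v \<in> phase_space ps" "w \<in> phase_space (concat (replicate n ps))" "u = v @ w"
    using phase_space_append[of u ps "concat (replicate n ps)"] by auto
  show ?case
    using trace_phase_point_tensor_power_Suc[OF M vw(1,2)] trace_phase_point_tensor_power_Suc[OF N vw(1,2)]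
      Suc.IH[OF vw(2)] nonneg[OF vw(1)] zero[OF vw(1)] vw(3)
    by (auto intro!: mult_nonneg_nonneg simp del: replicate.simps)
qed

section \<open>The impossibility argument\<close>

context small_state
begin

text \<open>In phase space the effect must vanish wherever the powers of the complement have weight,
  and the powers of \<open>witness\<close> have weight only there. Since \<open>witness\<close>
  dominates \<psi>, nothing is left for \<psi>. The bound \<open>\<le> 0\<close> directly
  contradicts a positive success probability.\<close>

lemma no_conclusive_effect:
  fixes n :: nat and E \<rho>1 :: "complex mat"
  defines "\<rho>1 \<equiv> (1 / (of_nat D - 1)) \<cdot>\<^sub>m (1\<^sub>m D - \<psi>)"
  assumes D1: "D > 1"
    and E: "positive_semidefinite (D ^ n) E" "pwf_effect (concat (replicate n ps)) E"
    and E0: "trace (E * tensor_power n \<rho>1) = 0"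
  shows "trace (E * tensor_power n \<psi>) \<le> 0"
proof -
  let ?ps = "concat (replicate n ps)"
  have dn: "prod_list ?ps = D ^ n" by (simp add: prod_list_copies D)
  note odd = odd_dims_copies[OF odd_dims, of n]
  have Ec: "E \<in> carrier_mat (prod_list ?ps) (prod_list ?ps)"
    using E by (simp add: positive_semidefinite_def dn)
  have r1: "\<rho>1 \<in> carrier_mat D D" using minus_carrier_mat[OF psi_carrier] by (simp add: \<rho>1_def)
  have tr: "trace (phase_point ps v * \<rho>1) = (1 / (of_nat D - 1)) * (1 - trace (phase_point ps v * \<psi>))"
    if v: "v \<in> phase_space ps" for v
  proof -
    note Av = A_carrier[OF v]
    have "phase_point ps v * (1\<^sub>m D - \<psi>) = phase_point ps v - phase_point ps v * \<psi>"
      using mult_minus_distrib_mat[OF Av one_carrier_mat psi_carrier] Av by simp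
    moreover have "trace \<dots> = 1 - trace (phase_point ps v * \<psi>)"
      using trace_minus[OF Av mult_carrier_mat[OF Av psi_carrier]] trace_phase_point[OF odd_dims v] by simp
    moreover have "phase_point ps v * \<rho>1 = (1 / (of_nat D - 1)) \<cdot>\<^sub>m (phase_point ps v * (1\<^sub>m D - \<psi>))"
      unfolding \<rho>1_def by (rule mult_smult_distrib[OF Av minus_carrier_mat[OF psi_carrier]])
    ultimately show ?thesis
      by (simp only: trace_smult[OF minus_carrier_mat[OF mult_carrier_mat[OF Av psi_carrier]]])
  qed
  have c: "1 / (of_nat D - 1) = complex_of_real (1 / (real D - 1))" by simp
  have c0: "0 \<le> 1 / (of_nat D - 1 :: complex)" "1 / (of_nat D - 1 :: complex) \<noteq> 0"
    unfolding c using D1 by (simp_all add: less_eq_complex_def)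
  have nonneg: "0 \<le> trace (phase_point ps v * \<rho>1)" if "v \<in> phase_space ps" for v
    unfolding tr[OF that] using trace_phase_point_psi_le_1[OF that]
    by (intro mult_nonneg_nonneg c0) (simp add: less_eq_complex_def)
  \<comment> \<open>By \<open>tr\<close>, the zeros of the Wigner function of the complement are
    exactly the unit points.\<close>
  have zero: "trace (phase_point ps v * witness) = 0"
    if "v \<in> phase_space ps" "trace (phase_point ps v * \<rho>1) = 0" for v
    using that trace_phase_point_witness[of v] c0(2) unfolding tr[OF that(1)] unit_points_def by simp
  have tp: "0 \<le> trace (phase_point ?ps u * tensor_power n \<rho>1) \<and>
      (trace (phase_point ?ps u * tensor_power n \<rho>1) = 0 \<longrightarrow>
       trace (phase_point ?ps u * tensor_power n witness) = 0)" if "u \<in> phase_space ?ps" for u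
  proof (rule trace_phase_point_tensor_power[OF _ _ nonneg zero that])
    show "\<rho>1 \<in> carrier_mat (prod_list ps) (prod_list ps)" using r1 by (simp flip: D)
    show "witness \<in> carrier_mat (prod_list ps) (prod_list ps)" using witness_carrier by (simp flip: D)
  qed
  have r1n: "tensor_power n \<rho>1 \<in> carrier_mat (prod_list ?ps) (prod_list ?ps)"
    using tensor_power_carrier[OF r1] by (simp add: dn)
  have wn: "tensor_power n witness \<in> carrier_mat (prod_list ?ps) (prod_list ?ps)"
    using tensor_power_carrier[OF witness_carrier] by (simp add: dn)
  have W: "0 \<le> trace (E * phase_point ?ps u)" if "u \<in> phase_space ?ps" for u
    using E(2) that by (simp add: pwf_effect_def wigner_effect_def)
  \<comment> \<open>The zero probability is a sum of products of nonnegative Wigner values, so each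
    product vanishes separately.\<close>
  have "(\<Sum>u\<in>phase_space ?ps. trace (E * phase_point ?ps u) * trace (phase_point ?ps u * tensor_power n \<rho>1)) = 0"
    using phase_point_reconstruction[OF odd Ec r1n] E0 by simp
  then have "trace (E * phase_point ?ps u) * trace (phase_point ?ps u * tensor_power n \<rho>1) = 0"
    if "u \<in> phase_space ?ps" for u
    using that W tp by (subst (asm) sum_nonneg_eq_0_iff) (auto intro!: mult_nonneg_nonneg)
  \<comment> \<open>At each point either the effect vanishes, or the power of the complement does
    and with it the power of \<open>witness\<close>.\<close>
  then have "trace (E * phase_point ?ps u) * trace (phase_point ?ps u * tensor_power n witness) = 0"
    if "u \<in> phase_space ?ps" for u
    using that tp[OF that] by fastforce
  then have "of_nat (prod_list ?ps) * trace (E * tensor_power n witness) = 0"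
    unfolding phase_point_reconstruction[OF odd Ec wn] by (intro sum.neutral) blast
  then have w0: "trace (E * tensor_power n witness) = 0"
    using D_pos by (simp only: dn) simp
  obtain Q where Q: "gram_cone (D ^ n) Q" "tensor_power n witness = tensor_power n \<psi> + Q"
    unfolding witness_def using tensor_power_add_cone[OF psi_cone excess_cone] by blast
  note pn = tensor_power_carrier[OF psi_carrier, of n] and Qc = gram_cone_carrier[OF Q(1)]
  note En = Ec[unfolded dn]
  have "trace (E * tensor_power n witness) = trace (E * tensor_power n \<psi>) + trace (E * Q)"
    unfolding Q(2) mult_add_distrib_mat[OF En pn Qc]
    by (rule trace_add[OF mult_carrier_mat[OF En pn] mult_carrier_mat[OF En Qc]])
  moreover have "0 \<le> trace (E * Q)" by (rule trace_mult_gram_cone_nonneg[OF E(1) Q(1)])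
  ultimately show ?thesis using w0 by (auto simp: less_eq_complex_def complex_eq_iff)
qed

end

theorem theorem1:
  fixes ps :: "nat list" and d n :: nat and \<rho>0 \<rho>1 :: "complex mat"
  assumes "ps \<noteq> []"
    and "\<And>p. p \<in> set ps \<Longrightarrow> prime p \<and> odd p"
    and "d = prod_list ps"
    and "pure_magic_state ps \<rho>0"
    and "\<rho>1 = (1 / (of_nat d - 1)) \<cdot>\<^sub>m (1\<^sub>m d - \<rho>0)"
    and "n > 0"
  shows "\<not> unambiguously_distinguishable_pwf (concat (replicate n ps))
           (tensor_power n \<rho>0) (tensor_power n \<rho>1)"
proof
  assume "unambiguously_distinguishable_pwf (concat (replicate n ps)) (tensor_power n \<rho>0) (tensor_power n \<rho>1)"
  \<comment> \<open>This is the effect \<open>E0\<close>, which never fires on the complement but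
    does fire on the magic state.\<close>
  then obtain E where E: "positive_semidefinite (prod_list (concat (replicate n ps))) E"
    "pwf_effect (concat (replicate n ps)) E"
    "trace (E * tensor_power n \<rho>1) = 0" "0 < trace (E * tensor_power n \<rho>0)"
    by (auto simp: unambiguously_distinguishable_pwf_def pwf_povm_def povm_def)
  have odd: "odd_dims ps" using assms(2) by (simp add: odd_dims_def)
  interpret pure_state ps d \<rho>0
    using assms(3,4) odd
    by unfold_locales
      (auto simp: pure_magic_state_def magic_state_def density_operator_def rank_one_projector_def)
  interpret small_state ps d \<rho>0
    by unfold_locales (rule magic_card_unit_points[OF assms(4)])
  \<comment> \<open>One prime factor already makes \<open>d\<close> exceed 1, so the denominator
    \<open>d - 1\<close> of the complement is positive.\<close>
  obtain p qs where p: "ps = p # qs" using assms(1) by (cases ps) auto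
  have "p > 1" using assms(2)[of p] prime_gt_1_nat[of p] by (simp add: p)
  moreover have "prod_list qs > 0" using odd prod_list_pos[of qs] by (simp add: p)
  ultimately have "1 < p" "p * 1 \<le> p * prod_list qs" by simp_all
  then have "d > 1" unfolding assms(3) p prod_list.Cons by (metis less_le_trans mult_1_right)
  then have "trace (E * tensor_power n \<rho>0) \<le> 0"
    using E assms(3,5) by (intro no_conclusive_effect) (simp_all add: prod_list_copies)
  then show False using E(4) by (auto simp: less_eq_complex_def less_complex_def)
qed

end
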